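(* Every nondiagonalizable 3-component system of conservation laws $$u^i_t=\frac{d}{dx}f^i(u),\qquad i=1,2,3,$$ of Temple class admits 5 conservation laws.
   Context: All considerations are local and smooth, over $\mathbb R$. The system is assumed strictly hyperbolic: the matrix $\nabla f=(\partial f^i/\partial u^j)$ has three distinct real eigenvalues $\lambda^\alpha$ with eigenvector fields $\xi_\alpha$ ($\nabla f\,\xi_\alpha=\lambda^\alpha\xi_\alpha$) and corresponding left eigenforms (characteristic forms) $\omega^\alpha=l^\alpha_i\,du^i$. The integral curves of the fields $\xi_\alpha$ in $u$-space are called rarefaction curves. The system is of Temple class if all its rarefaction curves are straight lines in the space of field variables $u=(u^1,u^2,u^3)$. The system is nondiagonalizable (not admitting a single Riemann invariant) if $d\omega^\alpha\wedge\omega^\alpha\neq0$ (no summation) for $\alpha=1,2,3$. A conservation law is a one-form $B(u)\,dx+A(u)\,dt$ closed on each solution $u(x,t)$ of the system; conservation laws are counted as linearly independent over $\mathbb R$ modulo the trivial ones $dx$, $dt$. Thus "admits 5 conservation laws" means that, besides the three laws $u^i\,dx+f^i\,dt$, there are two additional conservation laws $B\,dx+A\,dt$ and $N\,dx+M\,dt$ such that the seven one-forms $dx$, $dt$, $u^i\,dx+f^i\,dt$ ($i=1,2,3$), $B\,dx+A\,dt$, $N\,dx+M\,dt$ are linearly independent over $\mathbb R$. *)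

theory Defs
  imports "HOL-Analysis.Analysis"
begin

text \<open>
  Smooth means infinitely often differentiable; on an open subset of a finite-dimensional space
  the iterated directional derivatives below give the usual classes of k times continuously
  differentiable maps.
\<close>

primrec Ck_on :: "nat \<Rightarrow> 'a::euclidean_space set \<Rightarrow> ('a \<Rightarrow> 'b::real_normed_vector) \<Rightarrow> bool" where
  "Ck_on 0 S g \<longleftrightarrow> continuous_on S g"
| "Ck_on (Suc k) S g \<longleftrightarrow>
     (\<forall>x\<in>S. g differentiable (at x)) \<and> (\<forall>v. Ck_on k S (\<lambda>x. frechet_derivative g (at x) v))"

definition smooth_on :: "'a::euclidean_space set \<Rightarrow> ('a \<Rightarrow> 'b::real_normed_vector) \<Rightarrow> bool" where
  "smooth_on S g \<longleftrightarrow> (\<forall>k. Ck_on k S g)"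

text \<open>A one-form sends a point and a tangent vector to a number.\<close>

definition ext_deriv :: "('a::real_normed_vector \<Rightarrow> 'a \<Rightarrow> real) \<Rightarrow> 'a \<Rightarrow> 'a \<Rightarrow> 'a \<Rightarrow> real" where
  "ext_deriv \<omega> p v w =
     frechet_derivative (\<lambda>q. \<omega> q w) (at p) v - frechet_derivative (\<lambda>q. \<omega> q v) (at p) w"

definition closed_form_on :: "'a::real_normed_vector set \<Rightarrow> ('a \<Rightarrow> 'a \<Rightarrow> real) \<Rightarrow> bool" where
  "closed_form_on W \<omega> \<longleftrightarrow> (\<forall>p\<in>W. \<forall>v w. ext_deriv \<omega> p v w = 0)"

text \<open>The wedge product of an alternating bilinear form with a linear form.\<close>

definition wedge21 :: "('a \<Rightarrow> 'a \<Rightarrow> real) \<Rightarrow> ('a \<Rightarrow> real) \<Rightarrow> 'a \<Rightarrow> 'a \<Rightarrow> 'a \<Rightarrow> real" where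
  "wedge21 \<beta> \<omega> a b c = \<beta> a b * \<omega> c + \<beta> b c * \<omega> a + \<beta> c a * \<omega> b"

text \<open>
  Strict hyperbolicity of \<open>u\<^sub>t = f(u)\<^sub>x\<close> on \<open>U\<close>, together with a choice of characteristic
  speeds, eigenvector fields and left eigencovectors (all determined by \<open>f\<close> up to
  order and scaling; locally they can always be chosen smooth).
\<close>

definition strictly_hyperbolic ::
    "(real^3) set \<Rightarrow> (real^3 \<Rightarrow> real^3) \<Rightarrow> (3 \<Rightarrow> real^3 \<Rightarrow> real) \<Rightarrow> (3 \<Rightarrow> real^3 \<Rightarrow> real^3) \<Rightarrow>
     (3 \<Rightarrow> real^3 \<Rightarrow> real^3) \<Rightarrow> bool" where
  "strictly_hyperbolic U f \<mu> \<xi> l \<longleftrightarrow>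
     (\<forall>\<alpha>. smooth_on U (\<mu> \<alpha>) \<and> smooth_on U (\<xi> \<alpha>) \<and> smooth_on U (l \<alpha>)) \<and>
     (\<forall>u\<in>U. inj (\<lambda>\<alpha>. \<mu> \<alpha> u)) \<and>
     (\<forall>u\<in>U. \<forall>\<alpha>. \<xi> \<alpha> u \<noteq> 0 \<and> jacobian f (at u) *v \<xi> \<alpha> u = \<mu> \<alpha> u *\<^sub>R \<xi> \<alpha> u) \<and>
     (\<forall>u\<in>U. \<forall>\<alpha>. l \<alpha> u \<noteq> 0 \<and> l \<alpha> u v* jacobian f (at u) = \<mu> \<alpha> u *\<^sub>R l \<alpha> u)"

definition integral_curve ::
    "(real^3) set \<Rightarrow> (real^3 \<Rightarrow> real^3) \<Rightarrow> real set \<Rightarrow> (real \<Rightarrow> real^3) \<Rightarrow> bool" where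
  "integral_curve U X I \<gamma> \<longleftrightarrow>
     open I \<and> is_interval I \<and>
     (\<forall>s\<in>I. \<gamma> s \<in> U \<and> (\<gamma> has_vector_derivative X (\<gamma> s)) (at s))"

text \<open>The rarefaction curves are the integral curves of the \<open>\<xi> \<alpha>\<close>; \<open>collinear\<close>
  says that the curve lies on a straight line.\<close>

definition temple_class :: "(real^3) set \<Rightarrow> (3 \<Rightarrow> real^3 \<Rightarrow> real^3) \<Rightarrow> bool" where
  "temple_class U \<xi> \<longleftrightarrow> (\<forall>\<alpha> I \<gamma>. integral_curve U (\<xi> \<alpha>) I \<gamma> \<longrightarrow> collinear (\<gamma> ` I))"

definition char_form :: "(3 \<Rightarrow> real^3 \<Rightarrow> real^3) \<Rightarrow> 3 \<Rightarrow> real^3 \<Rightarrow> real^3 \<Rightarrow> real" where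
  "char_form l \<alpha> u v = (\<Sum>i\<in>UNIV. l \<alpha> u $ i * v $ i)"

definition nondiagonalizable :: "(real^3) set \<Rightarrow> (3 \<Rightarrow> real^3 \<Rightarrow> real^3) \<Rightarrow> bool" where
  "nondiagonalizable U l \<longleftrightarrow>
     (\<forall>u\<in>U. \<forall>\<alpha>. \<exists>a b c. wedge21 (ext_deriv (char_form l \<alpha>) u) (char_form l \<alpha> u) a b c \<noteq> 0)"

text \<open>Points of the plane of independent variables are pairs \<open>(x, t)\<close>.\<close>

definition solution_on ::
    "(real^3) set \<Rightarrow> (real^3 \<Rightarrow> real^3) \<Rightarrow> (real \<times> real) set \<Rightarrow> (real \<times> real \<Rightarrow> real^3) \<Rightarrow> bool" where
  "solution_on V f W u \<longleftrightarrow>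
     open W \<and> smooth_on W u \<and> u ` W \<subseteq> V \<and>
     (\<forall>p\<in>W. frechet_derivative u (at p) (0, 1) = frechet_derivative (\<lambda>q. f (u q)) (at p) (1, 0))"

text \<open>
  A one-form \<open>B(u) dx + A(u) dt\<close> is represented by the pair \<open>(B(u), A(u))\<close> of its coefficients;
  for such a pair \<open>w\<close> and a map \<open>u\<close>, \<open>along w u\<close> is the resulting one-form on the
  \<open>(x, t)\<close>-plane.
\<close>

type_synonym law = "real^3 \<Rightarrow> real \<times> real"

definition along :: "law \<Rightarrow> (real \<times> real \<Rightarrow> real^3) \<Rightarrow> real \<times> real \<Rightarrow> real \<times> real \<Rightarrow> real" where
  "along w u p h = fst (w (u p)) * fst h + snd (w (u p)) * snd h"

definition conservation_law :: "(real^3) set \<Rightarrow> (real^3 \<Rightarrow> real^3) \<Rightarrow> law \<Rightarrow> bool" where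
  "conservation_law V f w \<longleftrightarrow>
     smooth_on V w \<and> (\<forall>W u. solution_on V f W u \<longrightarrow> closed_form_on W (along w u))"

definition lin_indep_on :: "(real^3) set \<Rightarrow> law list \<Rightarrow> bool" where
  "lin_indep_on V ws \<longleftrightarrow>
     (\<forall>c :: nat \<Rightarrow> real. (\<forall>u\<in>V. (\<Sum>k<length ws. c k *\<^sub>R (ws ! k) u) = 0) \<longrightarrow>
        (\<forall>k<length ws. c k = 0))"

definition admits_five_conservation_laws :: "(real^3) set \<Rightarrow> (real^3 \<Rightarrow> real^3) \<Rightarrow> bool" where
  "admits_five_conservation_laws V f \<longleftrightarrow>
     (\<exists>B A N M :: real^3 \<Rightarrow> real.
        conservation_law V f (\<lambda>u. (B u, A u)) \<and>
        conservation_law V f (\<lambda>u. (N u, M u)) \<and>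
        lin_indep_on V
          [\<lambda>u. (1, 0), \<lambda>u. (0, 1),
           \<lambda>u. (u $ 1, f u $ 1), \<lambda>u. (u $ 2, f u $ 2), \<lambda>u. (u $ 3, f u $ 3),
           \<lambda>u. (B u, A u), \<lambda>u. (N u, M u)])"

end

theory Submission
  imports Defs
begin

text \<open>
  A function \<open>B\<close> is the density of a conservation law iff its Hessian is diagonal in the frame of
  eigenvectors \<open>\<xi>\<^sub>a\<close>. Write \<open>G\<^sup>c\<^sub>a\<^sub>b\<close> for the components of \<open>D\<xi>\<^sub>b(\<xi>\<^sub>a)\<close>. Straightness of the
  rarefaction curves means \<open>G\<^sup>c\<^sub>a\<^sub>a = 0\<close> for \<open>c \<noteq> a\<close>, and the symmetry of the second derivatives of
  \<open>f\<close> gives \<open>G\<^sup>c\<^sub>a\<^sub>b = (\<mu>\<^sub>a - \<mu>\<^sub>c) g\<^sub>c\<close> for distinct indices, where \<open>g\<^sub>c \<noteq> 0\<close> by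
  nondiagonalizability. If the Hessian of \<open>B\<close> is the sum of the \<open>k\<^sub>c (\<omega>\<^sup>c)\<^sup>2 / g\<^sub>c\<close>, the symmetry of
  its derivative becomes \<open>k\<^sub>1 + k\<^sub>2 + k\<^sub>3 = 0\<close> together with \<open>\<xi>\<^sub>a k\<^sub>b = s\<^sub>a\<^sub>b k\<^sub>b\<close> for \<open>a \<noteq> b\<close>. The
  flatness of the affine structure of \<open>u\<close>-space shows first that \<open>s\<^sub>a\<^sub>b = s\<^sub>a\<close> does not depend on \<open>b\<close>
  and then that the one-form with frame components \<open>s\<^sub>a\<close> is closed, hence locally equal to \<open>d\<phi>\<close>.
  So \<open>k\<^sub>c = C\<^sub>c exp \<phi>\<close> with constants of sum \<open>0\<close>: a two-parameter family, which yields two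
  conservation laws besides the trivial ones and the \<open>u\<^sup>i\<close>.
\<close>

section \<open>Smooth functions\<close>

lemma frechet_derivative_eqI:
  "(g has_derivative g') (at x) \<Longrightarrow> frechet_derivative g (at x) = g'"
  using frechet_derivative_at by metis

lemma frechet_derivative_cong_open:
  assumes "open S" "x \<in> S" "\<And>y. y \<in> S \<Longrightarrow> g y = h y"
  shows "frechet_derivative g (at x) = frechet_derivative h (at x)"
proof -
  have "(g has_derivative d) (at x) \<longleftrightarrow> (h has_derivative d) (at x)" for d
    using assms has_derivative_transform_within_open[OF _ assms(1,2)] by metis
  then show ?thesis by (simp add: frechet_derivative_def)
qed

text \<open>\<open>Ck_on\<close> refers to the values of g around each point; on an open set those
  outside \<open>S\<close> do not influence the derivatives at points of \<open>S\<close>, at any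
  order.\<close>

lemma Ck_on_cong:
  assumes "open S" "\<And>x. x \<in> S \<Longrightarrow> g x = h x" "Ck_on k S g"
  shows "Ck_on k S h"
  using assms(2,3)
proof (induction k arbitrary: g h)
  case 0
  then show ?case using continuous_on_cong by fastforce
next
  case (Suc k)
  have "h differentiable (at x)" if "x \<in> S" for x
    using Suc.prems that assms(1) has_derivative_transform_within_open
    unfolding differentiable_def Ck_on.simps by metis
  moreover have "Ck_on k S (\<lambda>x. frechet_derivative h (at x) v)" for v
  proof (rule Suc.IH)
    show "Ck_on k S (\<lambda>x. frechet_derivative g (at x) v)" using Suc.prems by simp
    show "frechet_derivative g (at x) v = frechet_derivative h (at x) v" if "x \<in> S" for x
      using frechet_derivative_cong_open[OF assms(1) that, of g h] Suc.prems(1) by simp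
  qed
  ultimately show ?case by simp
qed

lemma Ck_on_imp_continuous_on: "Ck_on k S g \<Longrightarrow> continuous_on S g"
  by (cases k) (auto simp: continuous_on_eq_continuous_within
      intro: differentiable_imp_continuous_within differentiable_at_withinI)

lemma Ck_on_Suc_imp: "Ck_on (Suc k) S g \<Longrightarrow> Ck_on k S g"
proof (induction k arbitrary: g)
  case 0
  then show ?case using Ck_on_imp_continuous_on by (metis Ck_on.simps(1))
qed simp

lemma Ck_on_subset: "Ck_on k S g \<Longrightarrow> T \<subseteq> S \<Longrightarrow> Ck_on k T g"
  by (induction k arbitrary: g) (auto intro: continuous_on_subset)

text \<open>\<open>Ck_on\<close> recurses through \<open>frechet_derivative\<close>, while the
  closure proofs below produce an explicit derivative, valid only on \<open>S\<close>; this rule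
  passes from one to the other.\<close>

lemma Ck_on_SucI:
  assumes "open S" "\<And>x. x \<in> S \<Longrightarrow> (g has_derivative g' x) (at x)"
    and "\<And>v. Ck_on k S (\<lambda>x. g' x v)"
  shows "Ck_on (Suc k) S g"
proof -
  have "Ck_on k S (\<lambda>x. frechet_derivative g (at x) v)" for v
    by (rule Ck_on_cong[OF assms(1) _ assms(3)]) (simp add: frechet_derivative_eqI[OF assms(2)])
  then show ?thesis using assms(2) by (auto simp: differentiable_def)
qed

lemma Ck_on_const: "open S \<Longrightarrow> Ck_on k S (\<lambda>x. c)"
proof (induction k arbitrary: c)
  case (Suc k)
  show ?case by (rule Ck_on_SucI[where g' = "\<lambda>x v. 0"]) (use Suc in auto)
qed simp

lemma Ck_on_has_derivative:
  "Ck_on (Suc k) S g \<Longrightarrow> x \<in> S \<Longrightarrow> (g has_derivative frechet_derivative g (at x)) (at x)"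
  by (simp add: frechet_derivative_works[symmetric])

lemma Ck_on_add:
  assumes "open S"
  shows "Ck_on k S g \<Longrightarrow> Ck_on k S h \<Longrightarrow> Ck_on k S (\<lambda>x. g x + h x)"
proof (induction k arbitrary: g h)
  case (Suc k)
  show ?case
    by (rule Ck_on_SucI[OF assms has_derivative_add[OF Ck_on_has_derivative[OF Suc.prems(1)]
            Ck_on_has_derivative[OF Suc.prems(2)]]])
      (use Suc in auto)
qed (auto intro: continuous_on_add)

lemma Ck_on_bounded_linear:
  assumes "open S" "bounded_linear L"
  shows "Ck_on k S g \<Longrightarrow> Ck_on k S (\<lambda>x. L (g x))"
proof (induction k arbitrary: g)
  case 0
  then show ?case using assms bounded_linear.continuous_on by auto
next
  case (Suc k)
  show ?case
    by (rule Ck_on_SucI[OF assms(1) bounded_linear.has_derivative[OF assms(2)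
            Ck_on_has_derivative[OF Suc.prems]]])
      (use Suc in auto)
qed

lemma Ck_on_mult:
  fixes g h :: "'a::euclidean_space \<Rightarrow> real"
  assumes "open S"
  shows "Ck_on k S g \<Longrightarrow> Ck_on k S h \<Longrightarrow> Ck_on k S (\<lambda>x. g x * h x)"
proof (induction k arbitrary: g h)
  case (Suc k)
  \<comment> \<open>The derivative of the product contains the factors themselves, so their order is
    lowered by one to match the induction hypothesis.\<close>
  show ?case
    by (rule Ck_on_SucI[OF assms has_derivative_mult[OF Ck_on_has_derivative[OF Suc.prems(1)]
            Ck_on_has_derivative[OF Suc.prems(2)]]])
      (use Suc Ck_on_Suc_imp[OF Suc.prems(1)] Ck_on_Suc_imp[OF Suc.prems(2)] in
        \<open>auto intro!: Ck_on_add[OF assms]\<close>)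
qed (auto intro: continuous_on_mult)

lemma Ck_on_inverse:
  fixes g :: "'a::euclidean_space \<Rightarrow> real"
  assumes "open S" "\<And>x. x \<in> S \<Longrightarrow> g x \<noteq> 0"
  shows "Ck_on k S g \<Longrightarrow> Ck_on k S (\<lambda>x. inverse (g x))"
proof (induction k)
  case 0
  then show ?case using assms by (auto intro: continuous_on_inverse)
next
  case (Suc k)
  \<comment> \<open>The derivative of the inverse contains the inverse again, whose order-k
    regularity comes from the induction hypothesis.\<close>
  have *: "Ck_on k S (\<lambda>x. inverse (g x))" using Suc Ck_on_Suc_imp by blast
  have "Ck_on k S (\<lambda>x. - (inverse (g x) * frechet_derivative g (at x) v * inverse (g x)))" for v
    by (rule Ck_on_bounded_linear[OF assms(1) bounded_linear_minus[OF bounded_linear_ident]])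
      (intro Ck_on_mult[OF assms(1)] *, use Suc.prems in simp)
  then show ?case
    by (intro Ck_on_SucI[OF assms(1) Deriv.has_derivative_inverse[OF assms(2)
            Ck_on_has_derivative[OF Suc.prems]]]) auto
qed

lemma Ck_on_exp:
  fixes g :: "'a::euclidean_space \<Rightarrow> real"
  assumes "open S"
  shows "Ck_on k S g \<Longrightarrow> Ck_on k S (\<lambda>x. exp (g x))"
proof (induction k)
  case (Suc k)
  have "Ck_on k S (\<lambda>x. exp (g x))" using Suc Ck_on_Suc_imp by blast
  moreover have "((\<lambda>x. exp (g x)) has_derivative (\<lambda>v. exp (g x) * frechet_derivative g (at x) v)) (at x)"
    if "x \<in> S" for x
    using has_derivative_exp[OF Ck_on_has_derivative[OF Suc.prems that]] by (simp add: mult.commute)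
  ultimately show ?case
    using Suc.prems by (intro Ck_on_SucI[OF assms, where g' = "\<lambda>x v. exp (g x) * frechet_derivative g (at x) v"])
      (auto intro!: Ck_on_mult[OF assms])
qed (auto intro: continuous_on_exp)

lemma smooth_on_const: "open S \<Longrightarrow> smooth_on S (\<lambda>x. c)"
  unfolding smooth_on_def using Ck_on_const by blast

lemma smooth_on_add: "open S \<Longrightarrow> smooth_on S g \<Longrightarrow> smooth_on S h \<Longrightarrow> smooth_on S (\<lambda>x. g x + h x)"
  unfolding smooth_on_def using Ck_on_add by blast

lemma smooth_on_bounded_linear:
  "open S \<Longrightarrow> bounded_linear L \<Longrightarrow> smooth_on S g \<Longrightarrow> smooth_on S (\<lambda>x. L (g x))"
  unfolding smooth_on_def using Ck_on_bounded_linear by blast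

lemma smooth_on_mult:
  fixes g h :: "'a::euclidean_space \<Rightarrow> real"
  shows "open S \<Longrightarrow> smooth_on S g \<Longrightarrow> smooth_on S h \<Longrightarrow> smooth_on S (\<lambda>x. g x * h x)"
  unfolding smooth_on_def using Ck_on_mult by blast

lemma smooth_on_diff:
  assumes "open S" "smooth_on S g" "smooth_on S h"
  shows "smooth_on S (\<lambda>x. g x - h x)"
  using smooth_on_add[OF assms(1,2) smooth_on_bounded_linear[OF assms(1)
        bounded_linear_minus[OF bounded_linear_ident] assms(3)]] by simp

lemma smooth_on_divide:
  fixes g h :: "'a::euclidean_space \<Rightarrow> real"
  assumes "open S" "smooth_on S g" "smooth_on S h" "\<And>x. x \<in> S \<Longrightarrow> h x \<noteq> 0"
  shows "smooth_on S (\<lambda>x. g x / h x)"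
  using assms Ck_on_inverse[OF assms(1,4)] unfolding smooth_on_def divide_inverse
  by (auto intro!: Ck_on_mult)

lemma smooth_on_exp:
  fixes g :: "'a::euclidean_space \<Rightarrow> real"
  shows "open S \<Longrightarrow> smooth_on S g \<Longrightarrow> smooth_on S (\<lambda>x. exp (g x))"
  unfolding smooth_on_def using Ck_on_exp by blast

lemma smooth_on_sum:
  assumes "open S" "\<And>i. i \<in> I \<Longrightarrow> smooth_on S (g i)"
  shows "smooth_on S (\<lambda>x. \<Sum>i\<in>I. g i x)"
proof (cases "finite I")
  case True
  then show ?thesis using assms(2)
    by (induction I) (auto intro: smooth_on_const smooth_on_add assms(1))
qed (simp add: smooth_on_const assms)

lemma smooth_on_subset: "smooth_on S g \<Longrightarrow> T \<subseteq> S \<Longrightarrow> smooth_on T g"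
  unfolding smooth_on_def using Ck_on_subset by blast

lemma smooth_on_has_derivative:
  "smooth_on S g \<Longrightarrow> x \<in> S \<Longrightarrow> (g has_derivative frechet_derivative g (at x)) (at x)"
  unfolding smooth_on_def using Ck_on_has_derivative by blast

lemma smooth_on_frechet_derivative:
  "smooth_on S g \<Longrightarrow> smooth_on S (\<lambda>x. frechet_derivative g (at x) v)"
  unfolding smooth_on_def using Ck_on.simps(2) by blast

lemma smooth_on_imp_continuous_on: "smooth_on S g \<Longrightarrow> continuous_on S g"
  unfolding smooth_on_def using Ck_on_imp_continuous_on by blast

lemma smooth_onI:
  assumes "open S" "\<And>x. x \<in> S \<Longrightarrow> (g has_derivative g' x) (at x)"
    and "\<And>v. smooth_on S (\<lambda>x. g' x v)"
  shows "smooth_on S g"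
  unfolding smooth_on_def
proof
  fix k
  \<comment> \<open>Order k + 1 is proved and then lowered to k, which covers k = 0 as well.\<close>
  show "Ck_on k S g"
    using Ck_on_SucI[OF assms(1,2), of k] assms(3) Ck_on_Suc_imp unfolding smooth_on_def by blast
qed

lemma smooth_on_component: "open S \<Longrightarrow> smooth_on S g \<Longrightarrow> smooth_on S (\<lambda>x. g x $ i)"
  using smooth_on_bounded_linear[OF _ bounded_linear_vec_nth] by blast

section \<open>Partial derivatives\<close>

definition pd :: "'n::finite \<Rightarrow> (real^'n \<Rightarrow> real) \<Rightarrow> real^'n \<Rightarrow> real" where
  "pd i g u = frechet_derivative g (at u) (axis i 1)"

lemma frechet_derivative_eq_pd:
  fixes g :: "real^'n::finite \<Rightarrow> real"
  assumes "g differentiable (at u)"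
  shows "frechet_derivative g (at u) v = (\<Sum>i\<in>UNIV. v $ i * pd i g u)"
proof -
  interpret linear "frechet_derivative g (at u)" using linear_frechet_derivative[OF assms] .
  have "v = (\<Sum>i\<in>UNIV. v $ i *\<^sub>R axis i 1)" by (simp add: vec_eq_iff axis_def if_distrib cong: if_cong)
  then have "frechet_derivative g (at u) v = frechet_derivative g (at u) (\<Sum>i\<in>UNIV. v $ i *\<^sub>R axis i 1)" by simp
  then show ?thesis by (simp add: sum scale pd_def)
qed

lemma pd_cong: "open S \<Longrightarrow> u \<in> S \<Longrightarrow> (\<And>x. x \<in> S \<Longrightarrow> g x = h x) \<Longrightarrow> pd i g u = pd i h u"
  unfolding pd_def using frechet_derivative_cong_open by metis

lemma smooth_on_pd: "smooth_on S g \<Longrightarrow> smooth_on S (pd i g)"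
  unfolding pd_def using smooth_on_frechet_derivative by blast

lemma smooth_on_differentiable: "smooth_on S g \<Longrightarrow> x \<in> S \<Longrightarrow> g differentiable (at x)"
  using smooth_on_has_derivative differentiableI by blast

section \<open>Symmetry of second derivatives\<close>

text \<open>The mean value theorem is used twice: in direction v for the increment of
  \<open>g\<close> in direction w, then in direction w for the derivative along v that this
  produces. The parallelogram condition keeps all intermediate points in \<open>S\<close>.\<close>

lemma mixed_difference_mean_value:
  fixes g :: "'a::euclidean_space \<Rightarrow> real"
  assumes g: "smooth_on S g" and "s > 0"
    and S: "\<And>a b. 0 \<le> a \<Longrightarrow> a \<le> s \<Longrightarrow> 0 \<le> b \<Longrightarrow> b \<le> s \<Longrightarrow> u + a *\<^sub>R v + b *\<^sub>R w \<in> S"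
  shows "\<exists>a b. 0 \<le> a \<and> a \<le> s \<and> 0 \<le> b \<and> b \<le> s \<and>
    g (u + s *\<^sub>R v + s *\<^sub>R w) - g (u + s *\<^sub>R v) - g (u + s *\<^sub>R w) + g u =
    s * s * frechet_derivative (\<lambda>q. frechet_derivative g (at q) v) (at (u + a *\<^sub>R v + b *\<^sub>R w)) w"
proof -
  let ?h = "\<lambda>q. frechet_derivative g (at q) v"
  have dg: "((\<lambda>a. g (u + a *\<^sub>R v + b *\<^sub>R w)) has_field_derivative ?h (u + a *\<^sub>R v + b *\<^sub>R w)) (at a)"
    if "0 \<le> a" "a \<le> s" "0 \<le> b" "b \<le> s" for a b
  proof -
    note D = smooth_on_has_derivative[OF g S[OF that]]
    interpret bounded_linear "frechet_derivative g (at (u + a *\<^sub>R v + b *\<^sub>R w))"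
      using D has_derivative_bounded_linear by blast
    have "((\<lambda>a. u + a *\<^sub>R v + b *\<^sub>R w) has_derivative (\<lambda>h. h *\<^sub>R v)) (at a)"
      by (auto intro!: derivative_eq_intros)
    from has_derivative_compose[OF this D] show ?thesis
      by (simp add: has_field_derivative_def scale mult_commute_abs)
  qed
  have dh: "((\<lambda>b. ?h (u + a *\<^sub>R v + b *\<^sub>R w)) has_field_derivative
      frechet_derivative ?h (at (u + a *\<^sub>R v + b *\<^sub>R w)) w) (at b)"
    if "0 \<le> a" "a \<le> s" "0 \<le> b" "b \<le> s" for a b
  proof -
    note D = smooth_on_has_derivative[OF smooth_on_frechet_derivative[OF g] S[OF that], of v]
    interpret bounded_linear "frechet_derivative ?h (at (u + a *\<^sub>R v + b *\<^sub>R w))"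
      using D has_derivative_bounded_linear by blast
    have "((\<lambda>b. u + a *\<^sub>R v + b *\<^sub>R w) has_derivative (\<lambda>h. h *\<^sub>R w)) (at b)"
      by (auto intro!: derivative_eq_intros)
    from has_derivative_compose[OF this D] show ?thesis
      by (simp add: has_field_derivative_def scale mult_commute_abs)
  qed
  have "\<exists>a>0. a < s \<and> (g (u + s *\<^sub>R v + s *\<^sub>R w) - g (u + s *\<^sub>R v + 0 *\<^sub>R w)) - (g (u + 0 *\<^sub>R v + s *\<^sub>R w) - g (u + 0 *\<^sub>R v + 0 *\<^sub>R w)) =
      (s - 0) * (?h (u + a *\<^sub>R v + s *\<^sub>R w) - ?h (u + a *\<^sub>R v + 0 *\<^sub>R w))"
  proof (intro MVT2 DERIV_diff)
    fix x assume "0 \<le> x" "x \<le> s"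
    then show "((\<lambda>a. g (u + a *\<^sub>R v + s *\<^sub>R w)) has_field_derivative ?h (u + x *\<^sub>R v + s *\<^sub>R w)) (at x)"
      "((\<lambda>a. g (u + a *\<^sub>R v + 0 *\<^sub>R w)) has_field_derivative ?h (u + x *\<^sub>R v + 0 *\<^sub>R w)) (at x)"
      using dg[of x s] dg[of x 0] \<open>s > 0\<close> by auto
  qed (use \<open>s > 0\<close> in auto)
  then obtain a where a: "0 < a" "a < s" and
    1: "(g (u + s *\<^sub>R v + s *\<^sub>R w) - g (u + s *\<^sub>R v)) - (g (u + s *\<^sub>R w) - g u) =
      s * (?h (u + a *\<^sub>R v + s *\<^sub>R w) - ?h (u + a *\<^sub>R v))"
    by auto
  have "\<exists>b>0. b < s \<and> ?h (u + a *\<^sub>R v + s *\<^sub>R w) - ?h (u + a *\<^sub>R v + 0 *\<^sub>R w) =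
      (s - 0) * frechet_derivative ?h (at (u + a *\<^sub>R v + b *\<^sub>R w)) w"
    using \<open>s > 0\<close> a by (intro MVT2) (auto intro!: dh)
  then obtain b where b: "0 < b" "b < s" and
    2: "?h (u + a *\<^sub>R v + s *\<^sub>R w) - ?h (u + a *\<^sub>R v) =
      s * frechet_derivative ?h (at (u + a *\<^sub>R v + b *\<^sub>R w)) w"
    by auto
  show ?thesis
    using a b 1 unfolding 2 by (intro exI[of _ a] exI[of _ b]) auto
qed

text \<open>The second difference of \<open>g\<close> over a parallelogram is symmetric in v and w.
  It equals s^2 times a value of either mixed derivative at points of the parallelogram, so
  continuity excludes a gap at \<open>u\<close>; \<open>e\<close> is half of the supposed
  gap.\<close>

lemma second_derivative_symmetric:
  fixes g :: "'a::euclidean_space \<Rightarrow> real"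
  assumes "open S" "smooth_on S g" "u \<in> S"
  shows "frechet_derivative (\<lambda>q. frechet_derivative g (at q) v) (at u) w =
    frechet_derivative (\<lambda>q. frechet_derivative g (at q) w) (at u) v" (is "?P u = ?Q u")
proof (rule ccontr)
  assume ne: "?P u \<noteq> ?Q u"
  define e where "e = \<bar>?P u - ?Q u\<bar> / 2"
  have "e > 0" using ne by (simp add: e_def)
  have cont: "continuous_on S ?P" "continuous_on S ?Q"
    using assms(2) by (simp_all add: smooth_on_frechet_derivative smooth_on_imp_continuous_on)
  from cont assms \<open>e > 0\<close> obtain d1 where d1: "d1 > 0" "\<And>x. x \<in> S \<Longrightarrow> dist x u < d1 \<Longrightarrow> dist (?P x) (?P u) < e"
    unfolding continuous_on_iff by metis
  from cont assms \<open>e > 0\<close> obtain d2 where d2: "d2 > 0" "\<And>x. x \<in> S \<Longrightarrow> dist x u < d2 \<Longrightarrow> dist (?Q x) (?Q u) < e"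
    unfolding continuous_on_iff by metis
  obtain d3 where d3: "d3 > 0" "ball u d3 \<subseteq> S" using assms openE by blast
  define d where "d = min d1 (min d2 d3)"
  \<comment> \<open>Small enough for the parallelogram with sides s v and s w to lie within distance
    \<open>d\<close> of \<open>u\<close>; the summand 1 keeps the denominator positive when v = w =
    0.\<close>
  define s where "s = d / (2 * (norm v + norm w + 1))"
  have dpos: "d > 0" using d1 d2 d3 by (simp add: d_def)
  have den: "norm v + norm w + 1 > 0" by (simp add: add_nonneg_pos)
  have "s > 0" using dpos den by (simp add: s_def)
  have near: "dist (u + a *\<^sub>R v + b *\<^sub>R w) u < d" if "0 \<le> a" "a \<le> s" "0 \<le> b" "b \<le> s" for a b
  proof -
    have "dist (u + a *\<^sub>R v + b *\<^sub>R w) u = norm (a *\<^sub>R v + b *\<^sub>R w)" by (simp add: dist_norm)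
    also have "\<dots> \<le> a * norm v + b * norm w"
      using norm_triangle_ineq[of "a *\<^sub>R v" "b *\<^sub>R w"] that by simp
    also have "\<dots> \<le> s * norm v + s * norm w" using that by (intro add_mono mult_right_mono) auto
    also have "\<dots> \<le> s * (norm v + norm w + 1)" using \<open>s > 0\<close> by (simp add: algebra_simps)
    also have "\<dots> = d / 2" using den by (simp add: s_def del: distrib_left_numeral)
    also have "\<dots> < d" using dpos by simp
    finally show ?thesis .
  qed
  have inS: "u + a *\<^sub>R v + b *\<^sub>R w \<in> S" if "0 \<le> a" "a \<le> s" "0 \<le> b" "b \<le> s" for a b
    using near[OF that] d3 by (auto simp: d_def dist_commute)
  obtain a b where ab: "0 \<le> a" "a \<le> s" "0 \<le> b" "b \<le> s" and
    1: "g (u + s *\<^sub>R v + s *\<^sub>R w) - g (u + s *\<^sub>R v) - g (u + s *\<^sub>R w) + g u = s * s * ?P (u + a *\<^sub>R v + b *\<^sub>R w)"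
    using mixed_difference_mean_value[OF assms(2) \<open>s > 0\<close> inS] by blast
  have inS': "u + a *\<^sub>R w + b *\<^sub>R v \<in> S" if "0 \<le> a" "a \<le> s" "0 \<le> b" "b \<le> s" for a b
    using inS[of b a] that by (simp add: algebra_simps)
  obtain a' b' where ab': "0 \<le> a'" "a' \<le> s" "0 \<le> b'" "b' \<le> s" and
    2: "g (u + s *\<^sub>R w + s *\<^sub>R v) - g (u + s *\<^sub>R w) - g (u + s *\<^sub>R v) + g u = s * s * ?Q (u + a' *\<^sub>R w + b' *\<^sub>R v)"
    using mixed_difference_mean_value[OF assms(2) \<open>s > 0\<close> inS'] by blast
  have "s * s * ?P (u + a *\<^sub>R v + b *\<^sub>R w) = s * s * ?Q (u + a' *\<^sub>R w + b' *\<^sub>R v)"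
    using 1 2 by (simp add: algebra_simps)
  then have eq: "?P (u + a *\<^sub>R v + b *\<^sub>R w) = ?Q (u + a' *\<^sub>R w + b' *\<^sub>R v)" using \<open>s > 0\<close> by simp
  have "dist (?P (u + a *\<^sub>R v + b *\<^sub>R w)) (?P u) < e"
    using d1(2)[OF inS[OF ab]] near[OF ab] by (simp add: d_def)
  moreover have "dist (?Q (u + a' *\<^sub>R w + b' *\<^sub>R v)) (?Q u) < e"
    using d2(2)[OF inS'[OF ab']] near[of b' a'] ab' by (simp add: d_def algebra_simps)
  ultimately show False using eq by (simp add: e_def dist_real_def abs_if split: if_splits)
qed

lemma pd_commute:
  "open S \<Longrightarrow> smooth_on S g \<Longrightarrow> u \<in> S \<Longrightarrow> pd i (pd j g) u = pd j (pd i g) u"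
  unfolding pd_def[abs_def] using second_derivative_symmetric by blast

section \<open>The Poincare lemma on a ball\<close>

text \<open>The potential is the integral of the form along the segment from the centre to
  \<open>x\<close>. It is differentiated under the integral sign, and the resulting integrand is an
  exact derivative in the segment parameter.\<close>

lemma poincare_ball:
  fixes b :: "'n::finite \<Rightarrow> real^'n \<Rightarrow> real"
  assumes b: "\<And>i. smooth_on (ball u0 r) (b i)"
    and closed: "\<And>i j u. u \<in> ball u0 r \<Longrightarrow> pd j (b i) u = pd i (b j) u"
  obtains B where "smooth_on (ball u0 r) B"
    and "\<And>u. u \<in> ball u0 r \<Longrightarrow> (B has_derivative (\<lambda>h. \<Sum>i\<in>UNIV. b i u * h $ i)) (at u)"
proof -
  let ?V = "ball u0 r"
  define p where "p x t = u0 + t *\<^sub>R (x - u0)" for x :: "real^'n" and t :: real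
  define bv where "bv x = (\<chi> i. b i x)" for x
  \<comment> \<open>\<open>G x t\<close> plays two roles: it is the derivative in t of t times the
    form at \<open>p x t\<close>, and, by closedness, the gradient in x of the integrand
    \<open>F x t\<close>.\<close>
  define G where "G x t = (\<chi> i. b i (p x t) + t * (\<Sum>j\<in>UNIV. (x - u0) $ j * pd j (b i) (p x t)))" for x t
  define F where "F x t = (\<Sum>i\<in>UNIV. b i (p x t) * (x - u0) $ i)" for x t
  define B where "B x = integral (cbox 0 1) (F x)" for x
  have pV: "p x t \<in> ?V" if "x \<in> ?V" "t \<in> cbox 0 1" for x t
  proof -
    have "norm (p x t - u0) \<le> norm (x - u0)"
      using that(2) by (simp add: p_def mult_left_le_one_le)
    then show ?thesis using that(1) by (simp add: dist_norm norm_minus_commute)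
  qed
  have cp: "continuous_on (?V \<times> cbox 0 1) (\<lambda>(x, t). p x t)"
    unfolding p_def case_prod_unfold by (intro continuous_intros)
  have pV': "(\<lambda>(x, t). p x t) ` (?V \<times> cbox 0 1) \<subseteq> ?V" using pV by auto
  have cb: "continuous_on (?V \<times> cbox 0 1) (\<lambda>(x, t). b i (p x t))"
    "continuous_on (?V \<times> cbox 0 1) (\<lambda>(x, t). pd j (b i) (p x t))" for i j
    using continuous_on_compose2[OF smooth_on_imp_continuous_on[OF b] cp pV']
      continuous_on_compose2[OF smooth_on_imp_continuous_on[OF smooth_on_pd[OF b]] cp pV']
    by (simp_all add: case_prod_unfold)
  have cG: "continuous_on (?V \<times> cbox 0 1) (\<lambda>(x, t). G x t)"
    unfolding G_def case_prod_unfold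
    using cb[unfolded case_prod_unfold] by (intro continuous_intros) auto
  have cGx: "continuous_on (cbox 0 1) (G x)" if "x \<in> ?V" for x
    using continuous_on_compose2[OF cG, of "cbox 0 1" "Pair x"] that
    by (simp add: continuous_on_Pair continuous_on_const continuous_on_id image_subset_iff)
  have cF: "continuous_on (cbox 0 1) (F x)" if "x \<in> ?V" for x
  proof -
    have "continuous_on (cbox 0 1) (\<lambda>t. b i (p x t))" for i
      using continuous_on_compose2[OF cb(1), of "cbox 0 1" "Pair x"] that
      by (simp add: continuous_on_Pair continuous_on_const continuous_on_id image_subset_iff)
    then show ?thesis unfolding F_def by (intro continuous_on_sum continuous_on_mult continuous_on_const)
  qed
  have db: "(b i has_derivative (\<lambda>h. \<Sum>j\<in>UNIV. h $ j * pd j (b i) x)) (at x)" if "x \<in> ?V" for i x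
    using smooth_on_has_derivative[OF b that]
    unfolding frechet_derivative_eq_pd[OF smooth_on_differentiable[OF b that], abs_def] .
  have dF: "((\<lambda>x. F x t) has_derivative blinfun_apply (blinfun_inner_right (G x t))) (at x within ?V)"
    if "x \<in> ?V" "t \<in> cbox 0 1" for x t
  proof -
    have dp: "((\<lambda>x. p x t) has_derivative (\<lambda>h. t *\<^sub>R h)) (at x)"
      unfolding p_def by (auto intro!: derivative_eq_intros)
    have "((\<lambda>x. F x t) has_derivative (\<lambda>h. \<Sum>i\<in>UNIV. b i (p x t) * h $ i +
        (\<Sum>j\<in>UNIV. (t *\<^sub>R h) $ j * pd j (b i) (p x t)) * (x - u0) $ i)) (at x)"
      unfolding F_def
    proof (rule has_derivative_sum)
      fix i :: 'n
      have "((\<lambda>x. (x - u0) $ i) has_derivative (\<lambda>h. h $ i)) (at x)"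
        using bounded_linear.has_derivative[OF bounded_linear_vec_nth
            has_derivative_diff[OF has_derivative_ident has_derivative_const]] by simp
      from has_derivative_mult[OF has_derivative_compose[OF dp db[OF pV[OF that]]] this]
      show "((\<lambda>x. b i (p x t) * (x - u0) $ i) has_derivative (\<lambda>h. b i (p x t) * h $ i +
        (\<Sum>j\<in>UNIV. (t *\<^sub>R h) $ j * pd j (b i) (p x t)) * (x - u0) $ i)) (at x)" .
    qed
    moreover have "(\<Sum>i\<in>UNIV. b i (p x t) * h $ i +
        (\<Sum>j\<in>UNIV. (t *\<^sub>R h) $ j * pd j (b i) (p x t)) * (x - u0) $ i) = G x t \<bullet> h" for h
    proof -
      have "(\<Sum>i\<in>UNIV. (\<Sum>j\<in>UNIV. (t *\<^sub>R h) $ j * pd j (b i) (p x t)) * (x - u0) $ i) =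
        (\<Sum>i\<in>UNIV. \<Sum>j\<in>UNIV. t * h $ j * pd j (b i) (p x t) * (x - u0) $ i)"
        by (simp add: sum_distrib_right)
      also have "\<dots> = (\<Sum>j\<in>UNIV. \<Sum>i\<in>UNIV. t * h $ j * pd j (b i) (p x t) * (x - u0) $ i)"
        by (rule sum.swap)
      \<comment> \<open>Closedness interchanges the indices, which makes the inner sum the
        derivative of \<open>b j\<close> in the direction \<open>x - u0\<close>.\<close>
      also have "\<dots> = (\<Sum>j\<in>UNIV. (t * (\<Sum>i\<in>UNIV. (x - u0) $ i * pd i (b j) (p x t))) * h $ j)"
        by (simp add: sum_distrib_left sum_distrib_right closed[OF pV[OF that]] mult_ac)
      finally show ?thesis
        by (simp add: G_def inner_vec_def sum.distrib distrib_right)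
    qed
    ultimately show ?thesis by (simp add: has_derivative_at_withinI)
  qed
  have intG: "integral (cbox 0 1) (G x) = bv x" if "x \<in> ?V" for x
  proof -
    have "((\<lambda>t. \<chi> i. t * b i (p x t)) has_vector_derivative G x t) (at t within {0..1})" if "t \<in> {0..1}" for t
    proof -
      have dp: "(p x has_derivative (\<lambda>h. h *\<^sub>R (x - u0))) (at t)"
        unfolding p_def by (auto intro!: derivative_eq_intros)
      have "((\<lambda>t. t * b i (p x t)) has_derivative (\<lambda>h. t * (\<Sum>j\<in>UNIV. (h *\<^sub>R (x - u0)) $ j * pd j (b i) (p x t)) +
          h * b i (p x t))) (at t)" for i
        by (intro has_derivative_mult has_derivative_compose[OF dp db] has_derivative_ident pV)
          (use that \<open>x \<in> ?V\<close> in auto)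
      moreover have "(\<lambda>h. t * (\<Sum>j\<in>UNIV. (h *\<^sub>R (x - u0)) $ j * pd j (b i) (p x t)) +
          h * b i (p x t)) = (\<lambda>h. (h *\<^sub>R G x t) $ i)" for i
        by (simp add: G_def fun_eq_iff algebra_simps sum_distrib_left)
      ultimately have "((\<lambda>t. \<chi> i. t * b i (p x t)) has_derivative (\<lambda>h. \<chi> i. (h *\<^sub>R G x t) $ i)) (at t)"
        by (subst has_derivative_componentwise_within) (auto simp: Basis_vec_def inner_axis)
      then show ?thesis
        unfolding has_vector_derivative_def by (simp only: vec_nth_inverse has_derivative_at_withinI)
    qed
    from fundamental_theorem_of_calculus[OF zero_le_one this]
    have "(G x has_integral (\<chi> i. 1 * b i (p x 1)) - (\<chi> i. 0 * b i (p x 0))) {0..1}" .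
    moreover have "(\<chi> i. 1 * b i (p x 1)) - (\<chi> i. 0 * b i (p x 0)) = bv x"
      by (simp add: bv_def p_def vec_eq_iff)
    ultimately show ?thesis by (metis box_real(2) integral_unique)
  qed
  have dB: "(B has_derivative (\<lambda>h. \<Sum>i\<in>UNIV. b i u * h $ i)) (at u)" if u: "u \<in> ?V" for u
  proof -
    have "(B has_derivative integral (cbox 0 1) (\<lambda>t. blinfun_inner_right (G u t))) (at u within ?V)"
      unfolding B_def
    proof (rule leibniz_rule[OF dF _ _ u])
      show "F x integrable_on cbox 0 1" if "x \<in> ?V" for x
        using cF[OF that] integrable_continuous by blast
      show "continuous_on (?V \<times> cbox 0 1) (\<lambda>(x, t). blinfun_inner_right (G x t))"
        using bounded_linear.continuous_on[OF bounded_linear_blinfun_inner_right cG]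
        by (simp add: case_prod_unfold)
    qed auto
    moreover have "integral (cbox 0 1) (\<lambda>t. blinfun_inner_right (G u t)) = blinfun_inner_right (bv u)"
      using integral_linear[OF integrable_continuous[OF cGx[OF u]] bounded_linear_blinfun_inner_right] intG[OF u]
      by (simp add: o_def)
    ultimately have "(B has_derivative (\<lambda>h. bv u \<bullet> h)) (at u)"
      using u by (simp add: at_within_open[of u ?V])
    then show ?thesis by (simp add: bv_def inner_vec_def)
  qed
  have "smooth_on ?V B"
    by (rule smooth_onI[OF open_ball dB])
      (auto intro!: smooth_on_sum smooth_on_mult[OF open_ball b] smooth_on_const)
  with dB that show thesis by blast
qed

lemma poincare_ball_pd:
  fixes b :: "'n::finite \<Rightarrow> real^'n \<Rightarrow> real"
  assumes "\<And>i. smooth_on (ball u0 r) (b i)"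
    and "\<And>i j u. u \<in> ball u0 r \<Longrightarrow> pd j (b i) u = pd i (b j) u"
  obtains B where "smooth_on (ball u0 r) B" "\<And>i u. u \<in> ball u0 r \<Longrightarrow> pd i B u = b i u"
proof -
  obtain B where B: "smooth_on (ball u0 r) B"
    and dB: "\<And>u. u \<in> ball u0 r \<Longrightarrow> (B has_derivative (\<lambda>h. \<Sum>i\<in>UNIV. b i u * h $ i)) (at u)"
    using poincare_ball[OF assms] by blast
  have "pd i B u = b i u" if "u \<in> ball u0 r" for i u
    by (simp add: pd_def frechet_derivative_eqI[OF dB[OF that]] axis_def if_distrib cong: if_cong)
  with B that show thesis by blast
qed

section \<open>Integral curves\<close>

text \<open>The operator norm of the derivative is at most the sum of its norms on the basis
  vectors, a continuous function and hence bounded on the compact ball; convexity of the ball then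
  permits the mean value inequality.\<close>

lemma smooth_on_lipschitz_on_cball:
  fixes X :: "'a::euclidean_space \<Rightarrow> 'b::euclidean_space"
  assumes "smooth_on U X" "cball u r \<subseteq> U"
  obtains L where "L \<ge> 0" "\<And>x y. x \<in> cball u r \<Longrightarrow> y \<in> cball u r \<Longrightarrow> norm (X x - X y) \<le> L * norm (x - y)"
proof -
  let ?D = "\<lambda>x. frechet_derivative X (at x)"
  have "continuous_on (cball u r) (\<lambda>x. \<Sum>b\<in>Basis. norm (?D x b))"
    by (intro continuous_on_sum continuous_on_norm
        continuous_on_subset[OF smooth_on_imp_continuous_on[OF smooth_on_frechet_derivative[OF assms(1)]] assms(2)])
  then have "bounded ((\<lambda>x. \<Sum>b\<in>Basis. norm (?D x b)) ` cball u r)"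
    by (intro compact_imp_bounded compact_continuous_image compact_cball)
  then obtain L where L: "L > 0" "\<And>x. x \<in> cball u r \<Longrightarrow> (\<Sum>b\<in>Basis. norm (?D x b)) \<le> L"
    unfolding bounded_pos by (metis abs_le_D1 imageI real_norm_def)
  have "onorm (?D x) \<le> L" if "x \<in> cball u r" for x
  proof (rule onorm_bound)
    fix v
    have "bounded_linear (?D x)"
      using smooth_on_has_derivative[OF assms(1)] that assms(2) has_derivative_bounded_linear by blast
    then interpret bounded_linear "?D x" .
    have "?D x v = ?D x (\<Sum>b\<in>Basis. (v \<bullet> b) *\<^sub>R b)" by (simp add: euclidean_representation)
    also have "norm \<dots> \<le> (\<Sum>b\<in>Basis. norm (?D x b) * norm v)"
      unfolding sum scale by (intro sum_norm_le) (auto simp: mult.commute Basis_le_norm mult_right_mono)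
    also have "\<dots> \<le> L * norm v"
      using L(2)[OF that] by (simp add: sum_distrib_right[symmetric] mult_right_mono)
    finally show "norm (?D x v) \<le> L * norm v" .
  qed (use L in simp)
  then have "norm (X x - X y) \<le> L * norm (x - y)" if "x \<in> cball u r" "y \<in> cball u r" for x y
    using that assms
    by (intro differentiable_bound[of "cball u r" X ?D])
      (auto intro!: has_derivative_at_withinI smooth_on_has_derivative[OF assms(1)])
  then show thesis using that L by (meson less_imp_le)
qed

text \<open>The integral from 0 to t is written as a difference of integrals starting at -d, so that
  negative t is covered by the same formula. The bound serves both the range and the contraction
  estimate of the Picard operator.\<close>

lemma integral_difference_bound:
  fixes h :: "real \<Rightarrow> 'a::euclidean_space"
  assumes "d > 0" "continuous_on {-d..d} h" "\<And>s. norm (h s) \<le> C" "t \<in> {-d..d}"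
  shows "norm (integral {-d..t} h - integral {-d..0} h) \<le> C * d"
proof -
  have C: "C \<ge> 0" using assms(3)[of 0] norm_ge_zero order_trans by blast
  have "norm (integral {-d..t} h - integral {-d..0} h) \<le> C * norm (t - 0)"
  proof (rule differentiable_bound[of "{-d..d}" _ "\<lambda>s v. v *\<^sub>R h s"])
    show "onorm (\<lambda>v. v *\<^sub>R h s) \<le> C" for s :: real
      by (rule onorm_bound[OF C]) (metis assms(3) mult.commute mult_right_mono norm_ge_zero norm_scaleR real_norm_def)
  qed (use assms integral_has_vector_derivative[OF assms(2)] in \<open>auto simp: has_vector_derivative_def\<close>)
  also have "\<dots> \<le> C * d" using assms C by (intro mult_left_mono) auto
  finally show ?thesis .
qed

text \<open>Picard iteration for the field composed with the nearest-point projection to a ball, which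
  makes it bounded and Lipschitz on the whole space.\<close>

lemma integral_curve_exists:
  fixes X :: "'a::euclidean_space \<Rightarrow> 'a"
  assumes "open U" "smooth_on U X" "u \<in> U"
  obtains d \<gamma> where "d > 0" "\<gamma> 0 = u"
    "\<And>s. s \<in> {-d<..<d} \<Longrightarrow> \<gamma> s \<in> U \<and> (\<gamma> has_vector_derivative X (\<gamma> s)) (at s)"
proof -
  obtain r where r: "r > 0" "cball u r \<subseteq> U" using assms open_contains_cball by blast
  let ?K = "cball u r"
  obtain L where L: "L \<ge> 0" "\<And>x y. x \<in> ?K \<Longrightarrow> y \<in> ?K \<Longrightarrow> norm (X x - X y) \<le> L * norm (x - y)"
    using smooth_on_lipschitz_on_cball[OF assms(2) r(2)] by blast
  define Y where "Y x = X (closest_point ?K x)" for x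
  have cpK: "closest_point ?K x \<in> ?K" for x using r by (intro closest_point_in_set) auto
  have cXK: "continuous_on ?K X"
    using continuous_on_subset[OF smooth_on_imp_continuous_on[OF assms(2)] r(2)] .
  then have "bounded (X ` ?K)" by (intro compact_imp_bounded compact_continuous_image compact_cball)
  then obtain M where M: "M > 0" "\<And>x. x \<in> ?K \<Longrightarrow> norm (X x) \<le> M" unfolding bounded_pos by auto
  have YM: "norm (Y x) \<le> M" for x using M cpK by (simp add: Y_def)
  have YL: "norm (Y x - Y y) \<le> L * norm (x - y)" for x y
  proof -
    have "norm (Y x - Y y) \<le> L * norm (closest_point ?K x - closest_point ?K y)"
      unfolding Y_def using L(2) cpK by blast
    also have "\<dots> \<le> L * norm (x - y)"
      using closest_point_lipschitz[of ?K x y] r L(1) by (intro mult_left_mono) (auto simp: dist_norm)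
    finally show ?thesis .
  qed
  have cY: "continuous_on UNIV Y"
    unfolding Y_def
    by (rule continuous_on_compose2[OF cXK continuous_on_closest_point]) (use r cpK in auto)
  \<comment> \<open>The first bound keeps the iterates inside the ball, the second makes the
    operator a contraction with constant 1/2; adding 1 to \<open>L\<close> allows
    \<open>L = 0\<close>.\<close>
  define d where "d = min (r / M) (1 / (2 * (L + 1)))"
  have d: "d > 0" "M * d \<le> r" "L * d \<le> 1/2"
  proof -
    show "d > 0" using r M L by (simp add: d_def)
    have "M * d \<le> M * (r / M)" using M by (intro mult_left_mono) (auto simp: d_def)
    then show "M * d \<le> r" using M by simp
    have "L * d \<le> L * (1 / (2 * (L + 1)))" using L by (intro mult_left_mono) (auto simp: d_def)
    also have "\<dots> \<le> 1/2" using L by (simp add: field_simps)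
    finally show "L * d \<le> 1/2" .
  qed
  \<comment> \<open>Clamping time to \<open>{-d..d}\<close> extends the iterates to the whole line,
    so that they lie in the complete space of bounded continuous functions.\<close>
  define c where "c t = max (-d) (min d t)" for t
  have c: "c t \<in> {-d..d}" for t using d by (auto simp: c_def)
  define J where "J \<gamma> t = integral {-d..t} (\<lambda>s. Y (\<gamma> s)) - integral {-d..0} (\<lambda>s. Y (\<gamma> s))" for \<gamma> t
  define \<Phi> where "\<Phi> \<gamma> t = u + J \<gamma> (c t)" for \<gamma> t
  have cYg: "continuous_on S (\<lambda>s. Y (apply_bcontfun \<gamma> s))" for S :: "real set" and \<gamma>
    by (rule continuous_on_compose2[OF cY]) auto
  have JM: "norm (J \<gamma> t) \<le> r" if "t \<in> {-d..d}" for \<gamma> :: "real \<Rightarrow>\<^sub>C 'a" and t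
    unfolding J_def using integral_difference_bound[OF d(1) cYg[of _ \<gamma>] YM that] d(2) by (rule order_trans)
  have JD: "(J \<gamma> has_vector_derivative Y (\<gamma> t)) (at t within {-d..d})" if "t \<in> {-d..d}"
    for \<gamma> :: "real \<Rightarrow>\<^sub>C 'a" and t
    unfolding J_def using integral_has_vector_derivative[OF cYg that]
    by (auto intro!: derivative_eq_intros)
  have cJ: "continuous_on {-d..d} (J \<gamma>)" for \<gamma> :: "real \<Rightarrow>\<^sub>C 'a"
    using JD has_vector_derivative_continuous continuous_on_eq_continuous_within by blast
  have Phi: "\<Phi> \<gamma> \<in> bcontfun" for \<gamma> :: "real \<Rightarrow>\<^sub>C 'a"
  proof -
    have "continuous_on UNIV (\<lambda>t. J \<gamma> (c t))"
      by (rule continuous_on_compose2[OF cJ]) (use c in \<open>auto simp: c_def intro!: continuous_intros\<close>)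
    moreover have "\<Phi> \<gamma> t \<in> ?K" for t
      using JM[OF c] by (simp add: \<Phi>_def dist_norm)
    then have "range (\<Phi> \<gamma>) \<subseteq> ?K" by blast
    then have "bounded (range (\<Phi> \<gamma>))" using bounded_subset bounded_cball by blast
    ultimately show ?thesis unfolding bcontfun_def by (auto simp: \<Phi>_def[abs_def] intro!: continuous_intros)
  qed
  have contr: "dist (Bcontfun (\<Phi> \<gamma>)) (Bcontfun (\<Phi> \<eta>)) \<le> 1/2 * dist \<gamma> \<eta>" for \<gamma> \<eta> :: "real \<Rightarrow>\<^sub>C 'a"
  proof (rule dist_bound)
    fix t
    have "J \<gamma> (c t) - J \<eta> (c t) = integral {-d..c t} (\<lambda>s. Y (\<gamma> s) - Y (\<eta> s)) -
        integral {-d..0} (\<lambda>s. Y (\<gamma> s) - Y (\<eta> s))"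
      unfolding J_def by (simp add: integral_diff integrable_continuous_real cYg)
    moreover have "norm (integral {-d..c t} (\<lambda>s. Y (\<gamma> s) - Y (\<eta> s)) -
        integral {-d..0} (\<lambda>s. Y (\<gamma> s) - Y (\<eta> s))) \<le> (L * dist \<gamma> \<eta>) * d"
    proof (rule integral_difference_bound[OF d(1) _ _ c])
      show "continuous_on {-d..d} (\<lambda>s. Y (\<gamma> s) - Y (\<eta> s))" by (intro continuous_intros cYg)
      fix s
      have "norm (Y (\<gamma> s) - Y (\<eta> s)) \<le> L * norm (\<gamma> s - \<eta> s)" by (rule YL)
      also have "\<dots> \<le> L * dist \<gamma> \<eta>"
        using dist_bounded[of \<gamma> s \<eta>] L(1) by (intro mult_left_mono) (auto simp: dist_norm)
      finally show "norm (Y (\<gamma> s) - Y (\<eta> s)) \<le> L * dist \<gamma> \<eta>" .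
    qed
    moreover have "(L * dist \<gamma> \<eta>) * d \<le> 1/2 * dist \<gamma> \<eta>"
      using mult_right_mono[OF d(3), of "dist \<gamma> \<eta>"] by (simp add: mult_ac)
    ultimately show "dist (Bcontfun (\<Phi> \<gamma>) t) (Bcontfun (\<Phi> \<eta>) t) \<le> 1/2 * dist \<gamma> \<eta>"
      by (simp add: Bcontfun_inverse Phi \<Phi>_def dist_norm)
  qed
  obtain \<gamma> :: "real \<Rightarrow>\<^sub>C 'a" where fixp: "Bcontfun (\<Phi> \<gamma>) = \<gamma>"
    using banach_fix_type[of "1/2" "\<lambda>\<gamma>. Bcontfun (\<Phi> (apply_bcontfun \<gamma>))"] contr by auto
  have g: "\<gamma> t = u + J \<gamma> (c t)" for t
    using fixp Bcontfun_inverse[OF Phi] by (metis \<Phi>_def)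
  have c0: "c t = t" if "t \<in> {-d..d}" for t using that by (auto simp: c_def)
  show thesis
  proof (rule that[OF d(1), of \<gamma>])
    show "\<gamma> 0 = u" using g[of 0] c0[of 0] d(1) by (simp add: J_def)
    fix s assume s: "s \<in> {-d<..<d}"
    \<comment> \<open>The fixed point stays in the ball, where the projection is the identity and
      \<open>Y\<close> agrees with \<open>X\<close>.\<close>
    have K: "\<gamma> s \<in> ?K" using g[of s] JM[OF c, of \<gamma> s] by (simp add: dist_norm)
    have "(J \<gamma> has_vector_derivative Y (\<gamma> s)) (at s)"
      using JD[of s \<gamma>] s by (metis at_within_Icc_at atLeastAtMost_iff greaterThanLessThan_iff less_imp_le)
    then have "((\<lambda>t. u + J \<gamma> t) has_vector_derivative Y (\<gamma> s)) (at s)"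
      by (auto intro!: derivative_eq_intros)
    then have "(\<gamma> has_vector_derivative Y (\<gamma> s)) (at s)"
      by (rule has_vector_derivative_transform_within_open[of _ _ _ "{-d<..<d}"])
        (use s g c0 in auto)
    moreover have "Y (\<gamma> s) = X (\<gamma> s)" using K by (simp add: Y_def closest_point_self)
    ultimately show "\<gamma> s \<in> U \<and> (\<gamma> has_vector_derivative X (\<gamma> s)) (at s)" using K r by auto
  qed
qed

text \<open>Along an integral curve contained in a line the field stays parallel to that line. A
  covector annihilating \<open>X u\<close> therefore annihilates \<open>X\<close> along the whole
  curve, and differentiating this at parameter 0 gives the claim.\<close>

lemma straight_integral_curves_derivative:
  assumes "open U" "smooth_on U X" "u \<in> U"
    and straight: "\<And>I \<gamma>. integral_curve U X I \<gamma> \<Longrightarrow> collinear (\<gamma> ` I)"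
    and "X u \<noteq> 0" "n \<bullet> X u = 0"
  shows "n \<bullet> frechet_derivative X (at u) (X u) = 0"
proof -
  obtain d \<gamma> where d: "d > 0" and g0: "\<gamma> 0 = u" and
    g: "\<And>s. s \<in> {-d<..<d} \<Longrightarrow> \<gamma> s \<in> U \<and> (\<gamma> has_vector_derivative X (\<gamma> s)) (at s)"
    using integral_curve_exists[OF assms(1-3)] by blast
  let ?I = "{-d<..<d}"
  have "integral_curve U X ?I \<gamma>"
    unfolding integral_curve_def using g by (auto simp: is_interval_oo)
  from straight[OF this] obtain a e where "\<forall>x\<in>\<gamma> ` ?I. \<exists>c. x = a + c *\<^sub>R e"
    unfolding collinear_alt by blast
  then have ae: "\<exists>c. \<gamma> s = a + c *\<^sub>R e" if "s \<in> ?I" for s using that by blast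
  have I0: "0 \<in> ?I" using d by simp
  have perp: "m \<bullet> X (\<gamma> s) = 0" if "m \<bullet> e = 0" "s \<in> ?I" for m s
  proof -
    have "((\<lambda>t. m \<bullet> \<gamma> t) has_vector_derivative m \<bullet> X (\<gamma> s)) (at s)"
      using bounded_linear.has_vector_derivative[OF bounded_linear_inner_right] g[OF that(2)] by blast
    moreover have "((\<lambda>t. m \<bullet> \<gamma> t) has_vector_derivative 0) (at s)"
    proof (rule has_vector_derivative_transform_within_open[OF _ _ that(2)])
      show "((\<lambda>t. m \<bullet> a) has_vector_derivative 0) (at s)" by (rule has_vector_derivative_const)
      show "m \<bullet> a = m \<bullet> \<gamma> t" if "t \<in> ?I" for t
        using ae[OF that] \<open>m \<bullet> e = 0\<close> by (auto simp: inner_add_right)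
    qed simp
    ultimately show ?thesis using vector_derivative_unique_at by blast
  qed
  \<comment> \<open>For \<open>e = 0\<close> every vector would be orthogonal to \<open>e\<close>,
    and \<open>perp\<close> applied to \<open>X u\<close> itself would force
    \<open>X u = 0\<close>.\<close>
  have "e \<noteq> 0"
    using perp[of "X u" 0] I0 g0 assms(5) by auto
  \<comment> \<open>\<open>m\<close> below is the part of \<open>X u\<close> orthogonal to the line;
    \<open>perp\<close> makes it orthogonal to \<open>X u\<close>, hence to itself.\<close>
  define k where "k = (X u \<bullet> e) / (e \<bullet> e)"
  define m where "m = X u - k *\<^sub>R e"
  have me: "m \<bullet> e = 0" using \<open>e \<noteq> 0\<close> by (simp add: m_def k_def inner_diff_left)
  have "m \<bullet> X u = 0" using perp[OF me I0] g0 by simp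
  then have "m \<bullet> m = 0" using me by (simp add: m_def inner_diff_right)
  then have Xu: "X u = k *\<^sub>R e" by (simp add: m_def)
  then have "n \<bullet> e = 0" using assms(5,6) by auto
  then have 0: "n \<bullet> X (\<gamma> s) = 0" if "s \<in> ?I" for s using perp that by blast
  have "(X has_derivative frechet_derivative X (at u)) (at (\<gamma> 0))"
    using smooth_on_has_derivative[OF assms(2,3)] g0 by simp
  moreover have "(\<gamma> has_derivative (\<lambda>h. h *\<^sub>R X u)) (at 0)"
    using g[OF I0] by (simp add: has_vector_derivative_def g0)
  ultimately
  have "((\<lambda>s. X (\<gamma> s)) has_derivative (\<lambda>h. frechet_derivative X (at u) (h *\<^sub>R X u))) (at 0)"
    using has_derivative_compose[of \<gamma> _ 0 UNIV X] by blast
  then have "((\<lambda>s. n \<bullet> X (\<gamma> s)) has_derivative (\<lambda>h. n \<bullet> frechet_derivative X (at u) (h *\<^sub>R X u))) (at 0)"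
    by (rule bounded_linear.has_derivative[OF bounded_linear_inner_right])
  moreover have "((\<lambda>s. n \<bullet> X (\<gamma> s)) has_derivative (\<lambda>h. 0)) (at 0)"
    by (rule has_derivative_transform_within_open[OF has_derivative_const[of 0] _ I0]) (use 0 in auto)
  ultimately have "(\<lambda>h::real. n \<bullet> frechet_derivative X (at u) (h *\<^sub>R X u)) = (\<lambda>h. 0)"
    by (rule has_derivative_unique)
  from fun_cong[OF this, of 1] show ?thesis by simp
qed

section \<open>Moving frames\<close>

lemma pd_mult:
  assumes "g differentiable (at u)" "h differentiable (at u)"
  shows "pd i (\<lambda>u. g u * h u) u = g u * pd i h u + pd i g u * h u"
  using has_derivative_mult[OF assms[unfolded frechet_derivative_works]]
  by (simp add: pd_def frechet_derivative_eqI)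

lemma pd_add:
  assumes "g differentiable (at u)" "h differentiable (at u)"
  shows "pd i (\<lambda>u. g u + h u) u = pd i g u + pd i h u"
  using has_derivative_add[OF assms[unfolded frechet_derivative_works]]
  by (simp add: pd_def frechet_derivative_eqI)

lemma pd_const: "pd i (\<lambda>u. c) u = 0"
  by (simp add: pd_def)

lemma pd_sum:
  assumes "\<And>k. k \<in> K \<Longrightarrow> g k differentiable (at u)"
  shows "pd i (\<lambda>u. \<Sum>k\<in>K. g k u) u = (\<Sum>k\<in>K. pd i (g k) u)"
proof -
  have "((\<lambda>u. \<Sum>k\<in>K. g k u) has_derivative (\<lambda>v. \<Sum>k\<in>K. frechet_derivative (g k) (at u) v)) (at u)"
    using assms by (intro has_derivative_sum) (simp add: frechet_derivative_works[symmetric])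
  then show ?thesis by (simp add: pd_def frechet_derivative_eqI)
qed

lemma pd_exp:
  assumes "g differentiable (at u)"
  shows "pd i (\<lambda>u. exp (g u)) u = exp (g u) * pd i g u"
  using has_derivative_exp[OF assms[unfolded frechet_derivative_works]]
  by (simp add: pd_def frechet_derivative_eqI)

text \<open>Expands sums over the index type for arbitrary distinct names of the three indices, so
  that the frame computations need no case split over 1, 2, 3.\<close>

lemma sum_UNIV_3_distinct:
  fixes a b c :: 3
  assumes "distinct [a, b, c]"
  shows "sum F UNIV = F a + F b + F c"
proof -
  have "{a, b, c} = (UNIV :: 3 set)"
    by (rule card_subset_eq) (use assms in auto)
  then have "sum F UNIV = sum F {a, b, c}" by simp
  then show ?thesis using assms by (simp add: add.assoc)
qed

section \<open>The flat connection in a moving frame\<close>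

text \<open>To be instantiated with the eigenvector fields as \<open>X\<close> and the left
  eigencovectors, rescaled to form the dual coframe, as \<open>W\<close>.\<close>

locale moving_frame =
  fixes U :: "(real^3) set" and X W :: "3 \<Rightarrow> real^3 \<Rightarrow> real^3"
  assumes open_U: "open U"
    and smooth_X: "smooth_on U (\<lambda>u. X a u $ i)"
    and smooth_W: "smooth_on U (\<lambda>u. W a u $ i)"
    and dual: "u \<in> U \<Longrightarrow> (\<Sum>i\<in>UNIV. W a u $ i * X b u $ i) = (if a = b then 1 else 0)"
begin

definition dd :: "3 \<Rightarrow> (real^3 \<Rightarrow> real) \<Rightarrow> real^3 \<Rightarrow> real" where
  "dd a g u = (\<Sum>i\<in>UNIV. X a u $ i * pd i g u)"

text \<open>Christoffel symbols of the flat connection: the derivative of \<open>X b\<close> along \<open>X a\<close> is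
  the sum of the \<open>G d a b u *\<^sub>R X d u\<close>.\<close>

definition G :: "3 \<Rightarrow> 3 \<Rightarrow> 3 \<Rightarrow> real^3 \<Rightarrow> real" where
  "G d a b u = (\<Sum>i\<in>UNIV. W d u $ i * dd a (\<lambda>u. X b u $ i) u)"

text \<open>A one-sided inverse of a square matrix is two-sided.\<close>

lemma dual': "u \<in> U \<Longrightarrow> (\<Sum>a\<in>UNIV. X a u $ i * W a u $ j) = (if i = j then 1 else 0)"
proof -
  assume u: "u \<in> U"
  let ?A = "(\<chi> a i. W a u $ i) :: real^3^3" and ?B = "(\<chi> i b. X b u $ i) :: real^3^3"
  have "?A ** ?B = mat 1"
    by (simp add: vec_eq_iff matrix_matrix_mult_def mat_def dual[OF u])
  then have "?B ** ?A = mat 1" using matrix_left_right_inverse by blast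
  then have "(?B ** ?A) $ i $ j = mat 1 $ i $ j" by simp
  then show ?thesis by (simp add: matrix_matrix_mult_def mat_def)
qed

lemma pd_eq_dd:
  assumes "u \<in> U"
  shows "pd i g u = (\<Sum>a\<in>UNIV. W a u $ i * dd a g u)"
proof -
  have "(\<Sum>a\<in>UNIV. W a u $ i * dd a g u) = (\<Sum>a\<in>UNIV. \<Sum>j\<in>UNIV. X a u $ j * W a u $ i * pd j g u)"
    by (simp add: dd_def sum_distrib_left mult_ac)
  also have "\<dots> = (\<Sum>j\<in>UNIV. (\<Sum>a\<in>UNIV. X a u $ j * W a u $ i) * pd j g u)"
    by (subst sum.swap) (simp add: sum_distrib_right)
  finally show ?thesis by (simp add: dual'[OF assms] if_distrib[where f="\<lambda>x. x * _"] cong: if_cong)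
qed

text \<open>Pairing with the covector \<open>W d\<close> reads off the coefficient of
  \<open>X d\<close>.\<close>

lemma frame_coeff_eq:
  assumes "u \<in> U" "\<And>i. (\<Sum>d\<in>UNIV. x d * X d u $ i) = (\<Sum>d\<in>UNIV. y d * X d u $ i)"
  shows "x d = y d"
proof -
  have *: "(\<Sum>i\<in>UNIV. W d u $ i * (\<Sum>e\<in>UNIV. z e * X e u $ i)) = z d" for z
  proof -
    have "(\<Sum>i\<in>UNIV. W d u $ i * (\<Sum>e\<in>UNIV. z e * X e u $ i)) =
        (\<Sum>i\<in>UNIV. \<Sum>e\<in>UNIV. z e * (W d u $ i * X e u $ i))"
      by (simp add: sum_distrib_left mult_ac)
    also have "\<dots> = (\<Sum>e\<in>UNIV. z e * (\<Sum>i\<in>UNIV. W d u $ i * X e u $ i))"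
      by (subst sum.swap) (simp add: sum_distrib_left)
    finally show ?thesis by (simp add: dual[OF assms(1)] if_distrib cong: if_cong)
  qed
  show ?thesis using *[of x] *[of y] assms(2) by simp
qed

lemma smooth_dd: "smooth_on U g \<Longrightarrow> smooth_on U (dd a g)"
  unfolding dd_def[abs_def]
  by (intro smooth_on_sum smooth_on_mult open_U smooth_X smooth_on_pd)

lemma smooth_G: "smooth_on U (G d a b)"
  unfolding G_def[abs_def]
  by (intro smooth_on_sum smooth_on_mult open_U smooth_W smooth_dd smooth_X)

lemma dd_mult:
  assumes "smooth_on U g" "smooth_on U h" "u \<in> U"
  shows "dd a (\<lambda>u. g u * h u) u = g u * dd a h u + dd a g u * h u"
  unfolding dd_def
  by (simp add: pd_mult[OF assms(1,2)[THEN smooth_on_differentiable[OF _ assms(3)]]]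
      distrib_left sum.distrib sum_distrib_left sum_distrib_right mult_ac)

lemma dd_add:
  assumes "smooth_on U g" "smooth_on U h" "u \<in> U"
  shows "dd a (\<lambda>u. g u + h u) u = dd a g u + dd a h u"
  unfolding dd_def
  by (simp add: pd_add[OF assms(1,2)[THEN smooth_on_differentiable[OF _ assms(3)]]]
      distrib_left sum.distrib)

lemma dd_const: "dd a (\<lambda>u. c) u = 0"
  by (simp add: dd_def pd_const)

lemma dd_cmult: "smooth_on U g \<Longrightarrow> u \<in> U \<Longrightarrow> dd a (\<lambda>u. c * g u) u = c * dd a g u"
  using dd_mult[OF smooth_on_const[OF open_U]] by (simp add: dd_const)

lemma dd_diff:
  assumes "smooth_on U g" "smooth_on U h" "u \<in> U"
  shows "dd a (\<lambda>u. g u - h u) u = dd a g u - dd a h u"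
  using dd_add[of g "\<lambda>u. -1 * h u" u a] dd_cmult[OF assms(2,3), of a "-1"] assms
    smooth_on_mult[OF open_U smooth_on_const[OF open_U] assms(2), of "-1"]
  by simp

lemma dd_sum:
  assumes "\<And>k. k \<in> K \<Longrightarrow> smooth_on U (g k)" "u \<in> U"
  shows "dd a (\<lambda>u. \<Sum>k\<in>K. g k u) u = (\<Sum>k\<in>K. dd a (g k) u)"
proof -
  have "dd a (\<lambda>u. \<Sum>k\<in>K. g k u) u = (\<Sum>i\<in>UNIV. \<Sum>k\<in>K. X a u $ i * pd i (g k) u)"
    by (simp add: dd_def sum_distrib_left pd_sum[OF smooth_on_differentiable[OF assms(1) assms(2)]])
  also have "\<dots> = (\<Sum>k\<in>K. dd a (g k) u)" unfolding dd_def by (rule sum.swap)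
  finally show ?thesis .
qed

lemma dd_cong: "u \<in> U \<Longrightarrow> (\<And>x. x \<in> U \<Longrightarrow> g x = h x) \<Longrightarrow> dd a g u = dd a h u"
  unfolding dd_def using pd_cong[OF open_U] by (metis (no_types, lifting) sum.cong)

lemma dd_divide:
  assumes "smooth_on U g" "smooth_on U h" "u \<in> U" "\<And>x. x \<in> U \<Longrightarrow> h x \<noteq> 0"
  shows "dd a (\<lambda>u. g u / h u) u = (dd a g u - g u / h u * dd a h u) / h u"
proof -
  have sm: "smooth_on U (\<lambda>u. g u / h u)" by (rule smooth_on_divide[OF open_U assms(1,2,4)])
  have "dd a g u = dd a (\<lambda>u. g u / h u * h u) u"
    by (rule dd_cong[OF assms(3)]) (simp add: assms(4))
  also have "\<dots> = g u / h u * dd a h u + dd a (\<lambda>u. g u / h u) u * h u"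
    by (rule dd_mult[OF sm assms(2,3)])
  finally show ?thesis using assms(4)[OF assms(3)] by (simp add: field_simps)
qed

lemma dd_X:
  assumes "u \<in> U"
  shows "dd a (\<lambda>u. X b u $ i) u = (\<Sum>d\<in>UNIV. G d a b u * X d u $ i)"
proof -
  have "(\<Sum>d\<in>UNIV. G d a b u * X d u $ i) =
      (\<Sum>d\<in>UNIV. \<Sum>j\<in>UNIV. X d u $ i * W d u $ j * dd a (\<lambda>u. X b u $ j) u)"
    by (simp add: G_def sum_distrib_left sum_distrib_right mult_ac)
  also have "\<dots> = (\<Sum>j\<in>UNIV. (\<Sum>d\<in>UNIV. X d u $ i * W d u $ j) * dd a (\<lambda>u. X b u $ j) u)"
    by (subst sum.swap) (simp add: sum_distrib_right)
  finally show ?thesis by (simp add: dual'[OF assms] if_distrib[where f="\<lambda>x. x * _"] cong: if_cong)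
qed

text \<open>Differentiating the constant pairings of \<open>W d\<close> with the \<open>X b\<close>
  moves the derivative from the coframe onto the frame.\<close>

lemma dd_W:
  assumes "u \<in> U"
  shows "dd a (\<lambda>u. W d u $ i) u = - (\<Sum>b\<in>UNIV. G d a b u * W b u $ i)"
proof -
  have 0: "(\<Sum>i\<in>UNIV. dd a (\<lambda>u. W d u $ i) u * X b u $ i) = - G d a b u" for b
  proof -
    have "dd a (\<lambda>u. \<Sum>i\<in>UNIV. W d u $ i * X b u $ i) u = 0"
      using dd_cong[OF assms dual] by (simp add: dd_const)
    moreover have "dd a (\<lambda>u. \<Sum>i\<in>UNIV. W d u $ i * X b u $ i) u =
        (\<Sum>i\<in>UNIV. dd a (\<lambda>u. W d u $ i * X b u $ i) u)"
      by (intro dd_sum smooth_on_mult open_U smooth_W smooth_X assms)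
    ultimately show ?thesis
      by (simp add: dd_mult[OF smooth_W smooth_X assms] sum.distrib G_def)
  qed
  have "(\<Sum>b\<in>UNIV. - G d a b u * W b u $ i) =
      (\<Sum>b\<in>UNIV. \<Sum>j\<in>UNIV. X b u $ j * W b u $ i * dd a (\<lambda>u. W d u $ j) u)"
    unfolding 0[symmetric] by (simp add: sum_distrib_left sum_distrib_right mult_ac)
  also have "\<dots> = (\<Sum>j\<in>UNIV. (\<Sum>b\<in>UNIV. X b u $ j * W b u $ i) * dd a (\<lambda>u. W d u $ j) u)"
    by (subst sum.swap) (simp add: sum_distrib_right)
  finally show ?thesis by (simp add: dual'[OF assms] sum_negf if_distrib[where f="\<lambda>x. x * _"] cong: if_cong)
qed

text \<open>The second-order terms cancel by symmetry of the second partial derivatives. What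
  remains are the derivatives of the frame fields, so the bracket of \<open>X a\<close> and
  \<open>X b\<close> has components \<open>G d a b u - G d b a u\<close>: the connection has no
  torsion.\<close>

lemma dd_commutator:
  assumes g: "smooth_on U g" and u: "u \<in> U"
  shows "dd a (dd b g) u - dd b (dd a g) u = (\<Sum>d\<in>UNIV. (G d a b u - G d b a u) * dd d g u)"
proof -
  have expand: "dd a (dd b g) u = (\<Sum>d\<in>UNIV. G d a b u * dd d g u) +
      (\<Sum>i\<in>UNIV. \<Sum>j\<in>UNIV. X b u $ i * X a u $ j * pd j (pd i g) u)" for a b
  proof -
    have "dd a (dd b g) u = (\<Sum>i\<in>UNIV. dd a (\<lambda>u. X b u $ i * pd i g u) u)"
      unfolding dd_def[of b g, abs_def]
      by (intro dd_sum smooth_on_mult open_U smooth_X smooth_on_pd g u)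
    also have "\<dots> = (\<Sum>i\<in>UNIV. X b u $ i * dd a (pd i g) u) + (\<Sum>i\<in>UNIV. dd a (\<lambda>u. X b u $ i) u * pd i g u)"
      by (simp add: dd_mult[OF smooth_X smooth_on_pd[OF g] u] sum.distrib)
    also have "(\<Sum>i\<in>UNIV. X b u $ i * dd a (pd i g) u) =
        (\<Sum>i\<in>UNIV. \<Sum>j\<in>UNIV. X b u $ i * X a u $ j * pd j (pd i g) u)"
      by (simp add: dd_def sum_distrib_left mult_ac)
    also have "(\<Sum>i\<in>UNIV. dd a (\<lambda>u. X b u $ i) u * pd i g u) =
        (\<Sum>i\<in>UNIV. \<Sum>d\<in>UNIV. G d a b u * (X d u $ i * pd i g u))"
      by (simp add: dd_X[OF u] sum_distrib_left sum_distrib_right mult_ac)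
    also have "\<dots> = (\<Sum>d\<in>UNIV. G d a b u * dd d g u)"
      by (subst sum.swap) (simp add: dd_def sum_distrib_left)
    finally show ?thesis by simp
  qed
  have "(\<Sum>i\<in>UNIV. \<Sum>j\<in>UNIV. X b u $ i * X a u $ j * pd j (pd i g) u) =
      (\<Sum>j\<in>UNIV. \<Sum>i\<in>UNIV. X a u $ j * X b u $ i * pd i (pd j g) u)"
    by (subst sum.swap) (simp add: pd_commute[OF open_U g u] mult_ac)
  then show ?thesis
    by (simp add: expand left_diff_distrib sum_subtractf)
qed

text \<open>Vanishing curvature in frame components: the coordinates of \<open>X c\<close> are
  ordinary functions, so their iterated derivatives obey \<open>dd_commutator\<close>, and both
  sides are expanded in the frame.\<close>

lemma flat:
  assumes u: "u \<in> U"
  shows "dd a (G d b c) u - dd b (G d a c) u +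
      (\<Sum>e\<in>UNIV. G e b c u * G d a e u - G e a c u * G d b e u) =
    (\<Sum>e\<in>UNIV. (G e a b u - G e b a u) * G d e c u)"
proof -
  \<comment> \<open>Component along \<open>X d\<close> of the second derivative of
    \<open>X c\<close>, taken first along \<open>X b\<close> and then along
    \<open>X a\<close>.\<close>
  define R where "R a b d = dd a (G d b c) u + (\<Sum>e\<in>UNIV. G e b c u * G d a e u)" for a b d
  have second: "dd a (dd b (\<lambda>u. X c u $ i)) u = (\<Sum>d\<in>UNIV. R a b d * X d u $ i)" for a b i
  proof -
    have "dd a (dd b (\<lambda>u. X c u $ i)) u = dd a (\<lambda>u. \<Sum>d\<in>UNIV. G d b c u * X d u $ i) u"
      by (rule dd_cong[OF u dd_X])
    also have "\<dots> = (\<Sum>d\<in>UNIV. dd a (\<lambda>u. G d b c u * X d u $ i) u)"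
      by (intro dd_sum smooth_on_mult open_U smooth_X smooth_G u)
    also have "\<dots> = (\<Sum>d\<in>UNIV. \<Sum>e\<in>UNIV. G d b c u * G e a d u * X e u $ i) +
        (\<Sum>d\<in>UNIV. dd a (G d b c) u * X d u $ i)"
      unfolding dd_mult[OF smooth_G smooth_X u] dd_X[OF u]
      by (simp add: sum.distrib sum_distrib_left mult_ac)
    also have "(\<Sum>d\<in>UNIV. \<Sum>e\<in>UNIV. G d b c u * G e a d u * X e u $ i) =
        (\<Sum>e\<in>UNIV. (\<Sum>d\<in>UNIV. G d b c u * G e a d u) * X e u $ i)"
      by (subst sum.swap) (simp add: sum_distrib_right)
    finally show ?thesis by (simp add: R_def sum.distrib distrib_right)
  qed
  have "R a b d - R b a d = (\<Sum>e\<in>UNIV. (G e a b u - G e b a u) * G d e c u)"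
  proof (rule frame_coeff_eq[OF u, where x = "\<lambda>d. R a b d - R b a d"
        and y = "\<lambda>d. \<Sum>e\<in>UNIV. (G e a b u - G e b a u) * G d e c u"])
    fix i
    have "(\<Sum>d\<in>UNIV. (R a b d - R b a d) * X d u $ i) =
        (\<Sum>e\<in>UNIV. (G e a b u - G e b a u) * (\<Sum>d\<in>UNIV. G d e c u * X d u $ i))"
      using dd_commutator[OF smooth_X u, of a b c i] unfolding second dd_X[OF u]
      by (simp add: left_diff_distrib sum_subtractf)
    also have "\<dots> = (\<Sum>e\<in>UNIV. \<Sum>d\<in>UNIV. (G e a b u - G e b a u) * G d e c u * X d u $ i)"
      by (simp add: sum_distrib_left mult_ac)
    also have "\<dots> = (\<Sum>d\<in>UNIV. (\<Sum>e\<in>UNIV. (G e a b u - G e b a u) * G d e c u) * X d u $ i)"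
      by (subst sum.swap) (simp add: sum_distrib_right)
    finally show "(\<Sum>d\<in>UNIV. (R a b d - R b a d) * X d u $ i) =
        (\<Sum>d\<in>UNIV. (\<Sum>e\<in>UNIV. (G e a b u - G e b a u) * G d e c u) * X d u $ i)" .
  qed
  then show ?thesis by (simp add: R_def sum_subtractf)
qed

end

section \<open>Frames of Temple class systems\<close>

text \<open>The cyclic successor, and below it the predecessor. They provide a canonical choice of
  the other two indices, which lets \<open>g\<close> and \<open>s\<close> be defined by a single
  formula each.\<close>

definition nxt :: "3 \<Rightarrow> 3" where "nxt a = (if a = 1 then 2 else if a = 2 then 3 else 1)"
definition prv :: "3 \<Rightarrow> 3" where "prv a = (if a = 1 then 3 else if a = 2 then 1 else 2)"

lemma distinct_nxt_prv: "distinct [a, nxt a, prv a]"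
  using exhaust_3[of a] by (auto simp: nxt_def prv_def)

lemma nxt_prv_cases:
  assumes "distinct [a, b, c]"
  obtains "b = nxt a" "c = prv a" | "b = prv a" "c = nxt a"
  using assms exhaust_3[of a] exhaust_3[of b] exhaust_3[of c] by (auto simp: nxt_def prv_def)

lemma third_index:
  fixes a b :: 3
  assumes "a \<noteq> b"
  obtains c where "distinct [a, b, c]"
proof -
  have "b = nxt a \<or> b = prv a"
    using assms exhaust_3[of a] exhaust_3[of b] by (auto simp: nxt_def prv_def)
  then show thesis using distinct_nxt_prv[of a] that[of "prv a"] that[of "nxt a"] by auto
qed

text \<open>\<open>m\<close> stands for the characteristic speeds. \<open>straight\<close> expresses
  the Temple property, \<open>dd_m\<close> and \<open>symmetry\<close> are components of the
  symmetry of the second derivatives of the flux, and \<open>nonintegrable\<close> says that the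
  bracket of \<open>X a\<close> and \<open>X b\<close> has a component along \<open>X c\<close>,
  which is the failure of the Frobenius condition for \<open>W c\<close>.\<close>

locale temple_frame = moving_frame +
  fixes m :: "3 \<Rightarrow> real^3 \<Rightarrow> real"
  assumes smooth_m: "smooth_on U (m a)"
    and m_distinct: "u \<in> U \<Longrightarrow> a \<noteq> b \<Longrightarrow> m a u \<noteq> m b u"
    and straight: "u \<in> U \<Longrightarrow> d \<noteq> a \<Longrightarrow> G d a a u = 0"
    and dd_m: "u \<in> U \<Longrightarrow> a \<noteq> b \<Longrightarrow> dd a (m b) u = (m a u - m b u) * G b b a u"
    and symmetry: "u \<in> U \<Longrightarrow> distinct [a, b, c] \<Longrightarrow> (m b u - m c u) * G c a b u = (m a u - m c u) * G c b a u"
    and nonintegrable: "u \<in> U \<Longrightarrow> distinct [a, b, c] \<Longrightarrow> G c a b u \<noteq> G c b a u"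
begin

text \<open>By \<open>symmetry\<close> the quotient of \<open>G c a b u\<close> by
  \<open>m a u - m c u\<close> is the same for both orders of the two indices other than
  \<open>c\<close>; the definition picks one of them.\<close>

definition g :: "3 \<Rightarrow> real^3 \<Rightarrow> real" where
  "g c u = G c (nxt c) (prv c) u / (m (nxt c) u - m c u)"

lemma G_eq_g:
  assumes "u \<in> U" "distinct [a, b, c]"
  shows "G c a b u = (m a u - m c u) * g c u"
proof -
  have d: "distinct [c, a, b]" using assms(2) by auto
  have n: "m (nxt c) u - m c u \<noteq> 0" using m_distinct[OF assms(1)] distinct_nxt_prv[of c] by auto
  from d show ?thesis
  proof (cases rule: nxt_prv_cases)
    case 1
    then show ?thesis using n by (simp add: g_def)
  next
    case 2
    then show ?thesis using n symmetry[OF assms] by (simp add: g_def field_simps)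
  qed
qed

lemma g_nonzero: "u \<in> U \<Longrightarrow> g c u \<noteq> 0"
proof
  assume u: "u \<in> U" and 0: "g c u = 0"
  have d: "distinct [nxt c, prv c, c]" "distinct [prv c, nxt c, c]" using distinct_nxt_prv[of c] by auto
  show False
    using nonintegrable[OF u d(1)] G_eq_g[OF u d(1)] G_eq_g[OF u d(2)] 0 by simp
qed

lemma smooth_g: "smooth_on U (g c)"
  unfolding g_def[abs_def]
  by (intro smooth_on_divide smooth_on_diff open_U smooth_G smooth_m)
    (use m_distinct distinct_nxt_prv[of c] in auto)

text \<open>The logarithmic derivative, written as a quotient because \<open>g\<close> may be
  negative.\<close>

abbreviation dlg :: "3 \<Rightarrow> 3 \<Rightarrow> real^3 \<Rightarrow> real" where
  "dlg a c u \<equiv> dd a (g c) u / g c u"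

lemma smooth_dlg: "smooth_on U (dlg a c)"
  by (intro smooth_on_divide open_U smooth_dd smooth_g g_nonzero)

text \<open>The derivative of \<open>g c\<close> is kept as \<open>dlg d c u * g c u\<close> so that
  \<open>g c u\<close> shows up as a common factor in the curvature identities.\<close>

lemma dd_G_distinct:
  assumes "u \<in> U" "distinct [a, b, c]"
  shows "dd d (G c a b) u = (dd d (m a) u - dd d (m c) u) * g c u + (m a u - m c u) * (dlg d c u * g c u)"
proof -
  have "dd d (G c a b) u = dd d (\<lambda>u. (m a u - m c u) * g c u) u"
    by (rule dd_cong[OF assms(1) G_eq_g[OF _ assms(2)]])
  also have "\<dots> = (m a u - m c u) * dd d (g c) u + dd d (\<lambda>u. m a u - m c u) u * g c u"
    by (rule dd_mult[OF smooth_on_diff[OF open_U smooth_m smooth_m] smooth_g assms(1)])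
  finally show ?thesis
    using g_nonzero[OF assms(1)] by (simp add: dd_diff[OF smooth_m smooth_m assms(1)])
qed

text \<open>The \<open>c\<close>-component of the vanishing curvature \<open>R(X a, X b) X a\<close>.\<close>

lemma curvature_aba:
  assumes u: "u \<in> U" and d: "distinct [a, b, c]"
  shows "2 * (m a u - m c u) * G b b a u - ((m a u - m c u) + (m a u - m b u)) * G c c a u +
    (m b u - m c u) * (G c a c u - G b a b u - G a a a u + dlg a c u) = 0"
proof -
  have d': "distinct [b, a, c]" "a \<noteq> b" "a \<noteq> c" "b \<noteq> c" using d by auto
  have 0: "dd b (G c a a) u = 0"
    using dd_cong[where a = b, OF u straight[where d = c and a = a]] d' by (simp add: dd_const)
  have 1: "dd a (G c b a) u =
      ((m a u - m b u) * G b b a u - (m a u - m c u) * G c c a u) * g c u + (m b u - m c u) * (dlg a c u * g c u)"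
    using dd_G_distinct[OF u d'(1)] dd_m[OF u] d' by simp
  have st: "G c a a u = 0" "G b a a u = 0" using straight[OF u] d' by auto
  \<comment> \<open>In this component of the curvature every surviving term contains
    \<open>G c a b u\<close> or \<open>G c b a u\<close> or a derivative of the latter, hence the
    factor \<open>g c u\<close>.\<close>
  have "g c u * (2 * (m a u - m c u) * G b b a u - ((m a u - m c u) + (m a u - m b u)) * G c c a u +
    (m b u - m c u) * (G c a c u - G b a b u - G a a a u + dlg a c u)) = 0"
    using flat[OF u, of a c b a]
    unfolding sum_UNIV_3_distinct[OF d] 0 1 st G_eq_g[OF u d] G_eq_g[OF u d'(1)]
    by algebra
  then show ?thesis using g_nonzero[OF u] by simp
qed

section \<open>The closed one-form with frame components \<open>s\<close>\<close>

text \<open>For b different from a, the Codazzi equations prescribe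
  \<open>2 * G b a b u - G b b a u\<close> as the logarithmic derivative along \<open>X a\<close> of
  the coefficient of the square of \<open>W b\<close>. Adding \<open>dlg a b u\<close> gives the
  prescription for that coefficient times \<open>g b\<close>. Here b is
  \<open>nxt a\<close>.\<close>

definition s :: "3 \<Rightarrow> real^3 \<Rightarrow> real" where
  "s a u = 2 * G (nxt a) a (nxt a) u - G (nxt a) (nxt a) a u + dlg a (nxt a) u"

text \<open>In the sum of \<open>curvature_aba\<close> for the two orders of the indices b and c,
  the terms with \<open>G a a a u\<close> cancel, and what is left is a multiple by
  \<open>m b u - m c u\<close> of the difference of the two candidate values.\<close>

lemma s_eq:
  assumes u: "u \<in> U" and "a \<noteq> b"
  shows "s a u = 2 * G b a b u - G b b a u + dlg a b u"
proof -
  have indep: "2 * G b a b u - G b b a u + dlg a b u = 2 * G c a c u - G c c a u + dlg a c u"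
    if d: "distinct [a, b, c]" for c b
  proof -
    have d': "distinct [a, c, b]" and bc: "m b u - m c u \<noteq> 0" using d m_distinct[OF u, of b c] by auto
    have "(m b u - m c u) * ((2 * G b a b u - G b b a u + dlg a b u) - (2 * G c a c u - G c c a u + dlg a c u)) = 0"
      using curvature_aba[OF u d] curvature_aba[OF u d'] by algebra
    then show ?thesis using bc by simp
  qed
  obtain c where d: "distinct [a, b, c]" using third_index[OF \<open>a \<noteq> b\<close>] .
  then show ?thesis
    by (cases rule: nxt_prv_cases) (use indep[OF d] in \<open>simp_all add: s_def\<close>)
qed

lemma smooth_s: "smooth_on U (s a)"
  unfolding s_def[abs_def]
  by (intro smooth_on_add smooth_on_diff smooth_on_mult smooth_on_const open_U smooth_G smooth_dlg)

lemma dd_s: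
  assumes u: "u \<in> U" and "b \<noteq> c"
  shows "dd a (s b) u = 2 * dd a (G c b c) u - dd a (G c c b) u + dd a (dlg b c) u"
proof -
  have "dd a (s b) u = dd a (\<lambda>u. 2 * G c b c u - G c c b u + dlg b c u) u"
    by (rule dd_cong[OF u s_eq[OF _ \<open>b \<noteq> c\<close>]])
  also have "\<dots> = dd a (\<lambda>u. 2 * G c b c u - G c c b u) u + dd a (dlg b c) u"
    by (intro dd_add smooth_on_diff smooth_on_mult smooth_on_const open_U smooth_G smooth_dlg u)
  also have "dd a (\<lambda>u. 2 * G c b c u - G c c b u) u = dd a (\<lambda>u. 2 * G c b c u) u - dd a (G c c b) u"
    by (intro dd_diff smooth_on_mult smooth_on_const open_U smooth_G u)
  finally show ?thesis by (simp add: dd_cmult[OF smooth_G u])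
qed

text \<open>The product terms of the quotient rule are symmetric in a and b, so only the commutator
  on \<open>g c\<close> survives.\<close>

lemma dd_dlg_commutator:
  assumes u: "u \<in> U"
  shows "dd a (dlg b c) u - dd b (dlg a c) u = (\<Sum>d\<in>UNIV. (G d a b u - G d b a u) * dlg d c u)"
proof -
  have "dd a (dlg b c) u = (dd a (dd b (g c)) u - dlg b c u * dd a (g c) u) / g c u" for a b
    by (rule dd_divide[OF smooth_dd[OF smooth_g] smooth_g u g_nonzero])
  then have "dd a (dlg b c) u - dd b (dlg a c) u = (dd a (dd b (g c)) u - dd b (dd a (g c)) u) / g c u"
    by (simp add: diff_divide_distrib mult.commute)
  also have "\<dots> = (\<Sum>d\<in>UNIV. (G d a b u - G d b a u) * dlg d c u)"
    unfolding dd_commutator[OF smooth_g u] by (simp add: sum_divide_distrib)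
  finally show ?thesis .
qed

text \<open>This is closedness of the form with frame components \<open>s\<close>. By
  \<open>s_eq\<close> both \<open>s a\<close> and \<open>s b\<close> can be written with the third
  index c, and then every derivative that occurs is controlled by a curvature identity or by a
  commutator.\<close>

lemma s_integrable:
  assumes u: "u \<in> U"
  shows "dd a (s b) u - dd b (s a) u = (\<Sum>d\<in>UNIV. (G d a b u - G d b a u) * s d u)"
proof (cases "a = b")
  case False
  obtain c where d: "distinct [a, b, c]" using third_index[OF False] .
  have ne: "a \<noteq> b" "b \<noteq> a" "a \<noteq> c" "c \<noteq> a" "b \<noteq> c" "c \<noteq> b" using d by auto
  have perm: "distinct [b, a, c]" "distinct [c, a, b]" "distinct [c, b, a]" "distinct [a, c, b]" "distinct [b, c, a]"
    using d by auto
  note sums = sum_UNIV_3_distinct[OF d]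
  note Gs = G_eq_g[OF u d] G_eq_g[OF u perm(1)] G_eq_g[OF u perm(2)] G_eq_g[OF u perm(3)]
    G_eq_g[OF u perm(4)] G_eq_g[OF u perm(5)]
  have st: "G x y y u = 0" if "x \<noteq> y" for x y using straight[OF u that] .
  note sts = st[OF ne(1)] st[OF ne(2)] st[OF ne(3)] st[OF ne(4)] st[OF ne(5)] st[OF ne(6)]
  \<comment> \<open>The curvature identity that supplies the difference of the doubled terms in
    \<open>dd a (s b) u - dd b (s a) u\<close>.\<close>
  have F1: "dd a (G c b c) u - dd b (G c a c) u = (m b u - m c u) * g c u * G a a c u - (m a u - m c u) * g c u * G b b c u
      + (G a a b u - G a b a u) * G c a c u + (G b a b u - G b b a u) * G c b c u + (m a u - m b u) * g c u * G c c c u"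
    using flat[OF u, of a c b c] unfolding sums Gs sts by algebra
  \<comment> \<open>These two replace \<open>dd a (G c c b) u\<close> and
    \<open>dd b (G c c a) u\<close> by derivatives along \<open>X c\<close>. In their difference the
    derivative of \<open>m c\<close> along \<open>X c\<close>, which \<open>dd_m\<close> does not
    determine, cancels; \<open>dlg c c u\<close> cancels against the commutator of the logarithmic
    derivatives.\<close>
  note F2 = flat[OF u, of c c a b, unfolded sums Gs sts dd_G_distinct[OF u d] dd_m[OF u ne(4)]]
  note F3 = flat[OF u, of c c b a, unfolded sums Gs sts dd_G_distinct[OF u perm(1)] dd_m[OF u ne(6)]]
  \<comment> \<open>Eliminates \<open>dlg c b u\<close>, which enters through the expression of
    \<open>s c u\<close>.\<close>
  note E = curvature_aba[OF u perm(2)]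
  have "dd a (s b) u - dd b (s a) u = 2 * (dd a (G c b c) u - dd b (G c a c) u)
      - dd a (G c c b) u + dd b (G c c a) u + (dd a (dlg b c) u - dd b (dlg a c) u)"
    by (simp add: dd_s[OF u ne(5)] dd_s[OF u ne(3)])
  also have "\<dots> = (G a a b u - G a b a u) * s a u + (G b a b u - G b b a u) * s b u + (m a u - m b u) * g c u * s c u"
    unfolding F1 dd_dlg_commutator[OF u] sums s_eq[OF u ne(3)] s_eq[OF u ne(5)] s_eq[OF u ne(6)] Gs
    using F2 F3 E by algebra
  also have "\<dots> = (\<Sum>d\<in>UNIV. (G d a b u - G d b a u) * s d u)"
    unfolding sums Gs by algebra
  finally show ?thesis .
qed simp

end

section \<open>Integration of the frame equations\<close>

context moving_frame begin

text \<open>A one-form is closed iff its covariant derivative for a torsion-free connection is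
  symmetric; the coordinate derivatives are recovered from the frame by
  \<open>pd_eq_dd\<close>.\<close>

lemma frame_form_closed:
  assumes u: "u \<in> U" and p: "\<And>a. smooth_on U (p a)"
    and int: "\<And>a b. dd a (p b) u - dd b (p a) u = (\<Sum>d\<in>UNIV. (G d a b u - G d b a u) * p d u)"
  shows "pd j (\<lambda>u. \<Sum>a\<in>UNIV. p a u * W a u $ i) u = pd i (\<lambda>u. \<Sum>a\<in>UNIV. p a u * W a u $ j) u"
proof -
  \<comment> \<open>Frame components of the covariant derivative of the form; the hypothesis
    \<open>int\<close> is exactly their symmetry.\<close>
  define Q where "Q b e = dd b (p e) u - (\<Sum>d\<in>UNIV. G d b e u * p d u)" for b e
  have Q: "Q b e = Q e b" for b e
    using int[of b e] by (simp add: Q_def left_diff_distrib sum_subtractf)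
  have dd: "dd b (\<lambda>u. \<Sum>a\<in>UNIV. p a u * W a u $ i) u = (\<Sum>e\<in>UNIV. Q b e * W e u $ i)" for b i
  proof -
    have "dd b (\<lambda>u. \<Sum>a\<in>UNIV. p a u * W a u $ i) u = (\<Sum>a\<in>UNIV. dd b (\<lambda>u. p a u * W a u $ i) u)"
      by (intro dd_sum smooth_on_mult open_U smooth_W p u)
    also have "\<dots> = (\<Sum>a\<in>UNIV. dd b (p a) u * W a u $ i) - (\<Sum>a\<in>UNIV. \<Sum>e\<in>UNIV. G a b e u * p a u * W e u $ i)"
      unfolding dd_mult[OF p smooth_W u] dd_W[OF u]
      by (simp add: sum_subtractf sum_distrib_left sum_distrib_right mult_ac)
    also have "(\<Sum>a\<in>UNIV. \<Sum>e\<in>UNIV. G a b e u * p a u * W e u $ i) =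
        (\<Sum>e\<in>UNIV. (\<Sum>a\<in>UNIV. G a b e u * p a u) * W e u $ i)"
      by (subst sum.swap) (simp add: sum_distrib_right)
    finally show ?thesis by (simp add: Q_def sum_subtractf left_diff_distrib)
  qed
  have "pd j (\<lambda>u. \<Sum>a\<in>UNIV. p a u * W a u $ i) u =
      (\<Sum>b\<in>UNIV. \<Sum>e\<in>UNIV. W b u $ j * (Q b e * W e u $ i))" for i j
    unfolding pd_eq_dd[OF u] dd by (simp add: sum_distrib_left)
  moreover have "(\<Sum>b\<in>UNIV. \<Sum>e\<in>UNIV. W b u $ j * (Q b e * W e u $ i)) =
      (\<Sum>b\<in>UNIV. \<Sum>e\<in>UNIV. W b u $ i * (Q b e * W e u $ j))"
    by (subst sum.swap) (simp add: Q[of _ _] mult_ac)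
  ultimately show ?thesis by simp
qed

text \<open>The Codazzi equations, in frame components, for a quadratic form that is diagonal in the
  frame.\<close>

lemma frame_quadratic_closed:
  assumes u: "u \<in> U" and k: "\<And>a. smooth_on U (k a)"
    and S: "\<And>a b d. (if b = d then dd a (k b) u else 0) - k d u * G d a b u - k b u * G b a d u =
      (if a = d then dd b (k a) u else 0) - k d u * G d b a u - k a u * G a b d u"
  shows "pd l (\<lambda>u. \<Sum>a\<in>UNIV. k a u * W a u $ i * W a u $ j) u =
    pd i (\<lambda>u. \<Sum>a\<in>UNIV. k a u * W a u $ l * W a u $ j) u"
proof -
  \<comment> \<open>For fixed j the j-th row of the quadratic form is a one-form with frame
    components \<open>p j a\<close>, so that \<open>frame_form_closed\<close> applies row by
    row.\<close>
  define p where "p j a u = k a u * W a u $ j" for j a u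
  have p: "smooth_on U (p j a)" for j a
    unfolding p_def[abs_def] by (intro smooth_on_mult open_U k smooth_W)
  have ddp: "dd a (p j b) u = dd a (k b) u * W b u $ j - (\<Sum>d\<in>UNIV. k b u * G b a d u * W d u $ j)" for a b
    unfolding p_def[abs_def] dd_mult[OF k smooth_W u] dd_W[OF u] by (simp add: sum_distrib_left mult_ac)
  have int: "dd a (p j b) u - dd b (p j a) u = (\<Sum>d\<in>UNIV. (G d a b u - G d b a u) * p j d u)" for a b
  proof -
    have delta: "dd a (k b) u * W b u $ j = (\<Sum>d\<in>UNIV. (if b = d then dd a (k b) u else 0) * W d u $ j)" for a b
      by (simp add: if_distrib[where f = "\<lambda>x. x * _"] cong: if_cong)
    have "dd a (p j b) u - dd b (p j a) u =
      (\<Sum>d\<in>UNIV. (((if b = d then dd a (k b) u else 0) - k b u * G b a d u) -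
        ((if a = d then dd b (k a) u else 0) - k a u * G a b d u)) * W d u $ j)"
      unfolding ddp delta by (simp only: sum_subtractf left_diff_distrib)
    also have "\<dots> = (\<Sum>d\<in>UNIV. (G d a b u - G d b a u) * p j d u)"
    proof (rule sum.cong)
      fix d
      have "((if b = d then dd a (k b) u else 0) - k b u * G b a d u) -
        ((if a = d then dd b (k a) u else 0) - k a u * G a b d u) = k d u * (G d a b u - G d b a u)"
        using S[of b d a] by (simp add: right_diff_distrib)
      then show "(((if b = d then dd a (k b) u else 0) - k b u * G b a d u) -
        ((if a = d then dd b (k a) u else 0) - k a u * G a b d u)) * W d u $ j = (G d a b u - G d b a u) * p j d u"
        by (simp add: p_def)
    qed simp
    finally show ?thesis .
  qed
  from frame_form_closed[OF u p int, of l i] show ?thesis by (simp add: p_def mult_ac)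
qed

end

context temple_frame begin

lemma potential_of_s:
  assumes ball: "U = ball u0 r"
  obtains \<phi> where "smooth_on U \<phi>" "\<And>u a. u \<in> U \<Longrightarrow> dd a \<phi> u = s a u"
proof -
  have "smooth_on (ball u0 r) (\<lambda>u. \<Sum>a\<in>UNIV. s a u * W a u $ i)" for i
    unfolding ball[symmetric] by (intro smooth_on_sum smooth_on_mult open_U smooth_s smooth_W)
  moreover have "pd j (\<lambda>u. \<Sum>a\<in>UNIV. s a u * W a u $ i) u = pd i (\<lambda>u. \<Sum>a\<in>UNIV. s a u * W a u $ j) u"
    if "u \<in> ball u0 r" for u i j
    using frame_form_closed[OF _ smooth_s s_integrable] that ball by blast
  ultimately obtain \<phi> where \<phi>: "smooth_on U \<phi>"
    and pd\<phi>: "\<And>i u. u \<in> U \<Longrightarrow> pd i \<phi> u = (\<Sum>a\<in>UNIV. s a u * W a u $ i)"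
    unfolding ball using poincare_ball_pd[of u0 r "\<lambda>i u. \<Sum>a\<in>UNIV. s a u * W a u $ i"] by blast
  have "dd b \<phi> u = s b u" if u: "u \<in> U" for b u
  proof -
    have "dd b \<phi> u = (\<Sum>i\<in>UNIV. \<Sum>a\<in>UNIV. s a u * (W a u $ i * X b u $ i))"
      by (simp add: dd_def pd\<phi>[OF u] sum_distrib_left mult_ac)
    also have "\<dots> = (\<Sum>a\<in>UNIV. s a u * (\<Sum>i\<in>UNIV. W a u $ i * X b u $ i))"
      by (subst sum.swap) (simp add: sum_distrib_left)
    finally show ?thesis by (simp add: dual[OF u] if_distrib cong: if_cong)
  qed
  with \<phi> that show thesis by blast
qed

section \<open>Hessians that are diagonal in the frame, and their fluxes\<close>

text \<open>The full coefficient of the square of \<open>W a\<close>, division by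
  \<open>g a u\<close> included. When \<phi> is a potential of \<open>s\<close>, this division
  lowers the logarithmic derivative from \<open>s\<close> to \<open>s\<close> minus
  \<open>dlg\<close>.\<close>

definition hess_coeff :: "(3 \<Rightarrow> real) \<Rightarrow> (real^3 \<Rightarrow> real) \<Rightarrow> 3 \<Rightarrow> real^3 \<Rightarrow> real" where
  "hess_coeff C \<phi> a u = C a * exp (\<phi> u) / g a u"

lemma smooth_hess_coeff: "smooth_on U \<phi> \<Longrightarrow> smooth_on U (hess_coeff C \<phi> a)"
  unfolding hess_coeff_def[abs_def]
  by (intro smooth_on_divide smooth_on_mult smooth_on_const smooth_on_exp open_U smooth_g g_nonzero)

lemma dd_hess_coeff:
  assumes \<phi>: "smooth_on U \<phi>" and "dd a \<phi> u = s a u" and u: "u \<in> U"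
  shows "dd a (hess_coeff C \<phi> b) u = hess_coeff C \<phi> b u * (s a u - dlg a b u)"
proof -
  have e: "dd a (\<lambda>u. exp (\<phi> u)) u = exp (\<phi> u) * s a u"
    unfolding assms(2)[symmetric]
    by (simp add: dd_def pd_exp[OF smooth_on_differentiable[OF \<phi> u]] sum_distrib_left mult_ac)
  have sm: "smooth_on U (\<lambda>u. C b * exp (\<phi> u))"
    by (intro smooth_on_mult smooth_on_const smooth_on_exp open_U \<phi>)
  have h: "dd a (hess_coeff C \<phi> b) u =
      (dd a (\<lambda>u. C b * exp (\<phi> u)) u - C b * exp (\<phi> u) / g b u * dd a (g b) u) / g b u"
    unfolding hess_coeff_def[abs_def] by (rule dd_divide[OF sm smooth_g u g_nonzero])
  have c: "dd a (\<lambda>u. C b * exp (\<phi> u)) u = C b * (exp (\<phi> u) * s a u)"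
    using dd_cmult[OF smooth_on_exp[OF open_U \<phi>] u] e by simp
  show ?thesis
    unfolding h c using g_nonzero[OF u, of b] by (simp add: hess_coeff_def field_simps)
qed

text \<open>If d is one of a and b, the equation is the differential condition that \<open>s\<close>
  was made for. If d is the third index, no derivative occurs and the equation is algebraic; this is
  where the constants must have sum zero.\<close>

lemma hess_coeff_codazzi:
  assumes \<phi>: "smooth_on U \<phi>" and d\<phi>: "\<And>a. dd a \<phi> u = s a u" and u: "u \<in> U"
    and C: "(\<Sum>a\<in>UNIV. C a) = 0"
  defines "k \<equiv> hess_coeff C \<phi>"
  shows "(if b = d then dd a (k b) u else 0) - k d u * G d a b u - k b u * G b a d u =
      (if a = d then dd b (k a) u else 0) - k d u * G d b a u - k a u * G a b d u"
proof (cases "a = b")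
  case False
  have dk: "dd a (k b) u = k b u * (2 * G b a b u - G b b a u)" if "a \<noteq> b" for a b
    using s_eq[OF u that] by (simp add: k_def dd_hess_coeff[OF \<phi> d\<phi> u])
  have st: "G x y y u = 0" if "x \<noteq> y" for x y using straight[OF u that] .
  consider "d = a" | "d = b" | "distinct [a, b, d]" using False by auto
  then show ?thesis
  proof cases
    case 1
    then show ?thesis using False dk[of b a] st[of b a] by (simp add: algebra_simps)
  next
    case 2
    then show ?thesis using False dk[of a b] st[of a b] by (simp add: algebra_simps)
  next
    case 3
    then have perm: "distinct [b, a, d]" "distinct [a, d, b]" "distinct [b, d, a]" by auto
    have kg: "k c u * g c u = C c * exp (\<phi> u)" for c
      using g_nonzero[OF u] by (simp add: k_def hess_coeff_def)
    have 0: "(k a u * g a u) + (k b u * g b u) + (k d u * g d u) = 0"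
      using C unfolding kg sum_UNIV_3_distinct[OF 3] by (simp add: distrib_right[symmetric])
    \<comment> \<open>The two sides differ by \<open>m a u - m b u\<close> times the vanishing sum
      in \<open>0\<close>.\<close>
    have "0 - k d u * ((m a u - m d u) * g d u) - k b u * ((m a u - m b u) * g b u) =
        0 - k d u * ((m b u - m d u) * g d u) - k a u * ((m b u - m a u) * g a u)"
      using 0 by algebra
    then show ?thesis
      using 3 unfolding G_eq_g[OF u 3] G_eq_g[OF u perm(1)] G_eq_g[OF u perm(2)] G_eq_g[OF u perm(3)]
      by simp
  qed
qed simp

text \<open>The Poincare lemma is applied twice: the Codazzi equations make each row of the matrix a
  gradient of some \<open>b j\<close>, and symmetry of the matrix makes the \<open>b j\<close>
  themselves a gradient.\<close>

lemma hessian_exists: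
  assumes ball: "U = ball u0 r" and \<phi>: "smooth_on U \<phi>" and d\<phi>: "\<And>u a. u \<in> U \<Longrightarrow> dd a \<phi> u = s a u"
    and C: "(\<Sum>a\<in>UNIV. C a) = 0"
  obtains B where "smooth_on U B"
    "\<And>u i j. u \<in> U \<Longrightarrow> pd i (pd j B) u = (\<Sum>a\<in>UNIV. hess_coeff C \<phi> a u * W a u $ i * W a u $ j)"
proof -
  let ?T = "\<lambda>j i u. \<Sum>a\<in>UNIV. hess_coeff C \<phi> a u * W a u $ i * W a u $ j"
  have smT: "smooth_on (ball u0 r) (?T j i)" for i j
    unfolding ball[symmetric] by (intro smooth_on_sum smooth_on_mult open_U smooth_hess_coeff smooth_W \<phi>)
  have clT: "pd l (?T j i) u = pd i (?T j l) u" if "u \<in> ball u0 r" for u i j l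
    using frame_quadratic_closed[OF _ smooth_hess_coeff[OF \<phi>] hess_coeff_codazzi[OF \<phi> d\<phi> _ C]] that ball by blast
  have "\<forall>j. \<exists>b. smooth_on (ball u0 r) b \<and> (\<forall>i. \<forall>u\<in>ball u0 r. pd i b u = ?T j i u)"
  proof
    fix j
    show "\<exists>b. smooth_on (ball u0 r) b \<and> (\<forall>i. \<forall>u\<in>ball u0 r. pd i b u = ?T j i u)"
      by (rule poincare_ball_pd[of u0 r "?T j", OF smT clT]) blast+
  qed
  from choice[OF this] obtain b where "\<forall>j. smooth_on (ball u0 r) (b j) \<and>
      (\<forall>i. \<forall>u\<in>ball u0 r. pd i (b j) u = ?T j i u)" ..
  then have b: "smooth_on (ball u0 r) (b j)" "u \<in> ball u0 r \<Longrightarrow> pd i (b j) u = ?T j i u" for i j u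
    by auto
  have clb: "pd i (b j) u = pd j (b i) u" if "u \<in> ball u0 r" for i j u
    unfolding b(2)[OF that] by (simp add: mult_ac)
  obtain B where B: "smooth_on U B" "\<And>i u. u \<in> U \<Longrightarrow> pd i B u = b i u"
    unfolding ball using poincare_ball_pd[of u0 r b, OF b(1) clb] by blast
  have "pd i (pd j B) u = ?T j i u" if u: "u \<in> U" for u i j
    using pd_cong[where i = i, OF open_U u B(2)[of _ j]] b(2) u ball by simp
  with B(1) that show thesis by blast
qed

text \<open>The form dB composed with df is closed iff the Hessian of B times the Jacobian of
  \<open>f\<close> is symmetric. Since the \<open>W a\<close> are left eigencovectors, that product
  is again diagonal in the coframe, with coefficients \<open>k a u * m a u\<close>.\<close>

lemma flux_exists:
  assumes ball: "U = ball u0 r" and B: "smooth_on U B"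
    and hess: "\<And>u i j. u \<in> U \<Longrightarrow> pd i (pd j B) u = (\<Sum>a\<in>UNIV. k a u * W a u $ i * W a u $ j)"
    and f: "\<And>j. smooth_on U (\<lambda>u. f u $ j)"
    and eigen: "\<And>u a i. u \<in> U \<Longrightarrow> (\<Sum>j\<in>UNIV. W a u $ j * pd i (\<lambda>u. f u $ j) u) = m a u * W a u $ i"
  obtains A where "smooth_on U A"
    "\<And>u i. u \<in> U \<Longrightarrow> pd i A u = (\<Sum>j\<in>UNIV. pd j B u * pd i (\<lambda>u. f u $ j) u)"
proof -
  let ?b = "\<lambda>i u. \<Sum>j\<in>UNIV. pd j B u * pd i (\<lambda>u. f u $ j) u"
  have sm: "smooth_on (ball u0 r) (?b i)" for i
    unfolding ball[symmetric] by (intro smooth_on_sum smooth_on_mult open_U smooth_on_pd B f)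
  have cl: "pd l (?b i) u = pd i (?b l) u" if "u \<in> ball u0 r" for i l u
  proof -
    have u: "u \<in> U" using that ball by simp
    have e: "pd l (?b i) u = (\<Sum>a\<in>UNIV. k a u * m a u * W a u $ l * W a u $ i) +
        (\<Sum>j\<in>UNIV. pd j B u * pd l (pd i (\<lambda>u. f u $ j)) u)" for i l
    proof -
      have dB: "pd j B differentiable (at u)" and df: "pd i (\<lambda>u. f u $ j) differentiable (at u)" for i j
        using smooth_on_differentiable[OF smooth_on_pd u] B f by blast+
      have "pd l (?b i) u = (\<Sum>j\<in>UNIV. pd l (\<lambda>u. pd j B u * pd i (\<lambda>u. f u $ j) u) u)"
        by (rule pd_sum) (intro differentiable_mult dB df)
      also have "\<dots> = (\<Sum>j\<in>UNIV. pd l (pd j B) u * pd i (\<lambda>u. f u $ j) u) +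
          (\<Sum>j\<in>UNIV. pd j B u * pd l (pd i (\<lambda>u. f u $ j)) u)"
        by (simp add: pd_mult[OF dB df] sum.distrib)
      also have "(\<Sum>j\<in>UNIV. pd l (pd j B) u * pd i (\<lambda>u. f u $ j) u) =
          (\<Sum>j\<in>UNIV. \<Sum>a\<in>UNIV. k a u * W a u $ l * (W a u $ j * pd i (\<lambda>u. f u $ j) u))"
        by (simp add: hess[OF u] sum_distrib_left sum_distrib_right mult_ac)
      also have "\<dots> = (\<Sum>a\<in>UNIV. k a u * W a u $ l * (\<Sum>j\<in>UNIV. W a u $ j * pd i (\<lambda>u. f u $ j) u))"
        by (subst sum.swap) (simp add: sum_distrib_left)
      finally show ?thesis by (simp add: eigen[OF u] mult_ac)
    qed
    \<comment> \<open>The first sum is symmetric in i and l as it stands, the second by commuting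
      the partial derivatives of \<open>f\<close>.\<close>
    show ?thesis
      unfolding e by (simp add: pd_commute[OF open_U f u, of l i] mult_ac)
  qed
  obtain A where "smooth_on U A" "\<And>i u. u \<in> U \<Longrightarrow> pd i A u = ?b i u"
    unfolding ball using poincare_ball_pd[of u0 r ?b, OF sm cl] by blast
  with that show thesis by blast
qed

end

section \<open>Conservation laws\<close>

lemma smooth_on_Pair:
  assumes "open S" "smooth_on S g" "smooth_on S h"
  shows "smooth_on S (\<lambda>x. (g x, h x))"
proof -
  have "smooth_on S (\<lambda>x. (g x, 0) + (0, h x))"
    using assms smooth_on_bounded_linear[OF assms(1) bounded_linear_Pair[OF bounded_linear_ident bounded_linear_zero] assms(2)]
      smooth_on_bounded_linear[OF assms(1) bounded_linear_Pair[OF bounded_linear_zero bounded_linear_ident] assms(3)]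
    by (intro smooth_on_add) auto
  then show ?thesis by simp
qed

lemma frechet_derivative_component:
  assumes "f differentiable (at u)"
  shows "frechet_derivative (\<lambda>u. f u $ i) (at u) v = frechet_derivative f (at u) v $ i"
  by (rule fun_cong[OF frechet_derivative_eqI[OF bounded_linear.has_derivative[OF bounded_linear_vec_nth
          assms[unfolded frechet_derivative_works]]]])

lemma frechet_derivative_component_eq_pd:
  fixes f :: "real^'n::finite \<Rightarrow> real^'m::finite"
  assumes "f differentiable (at u)"
  shows "frechet_derivative f (at u) v $ i = (\<Sum>j\<in>UNIV. v $ j * pd j (\<lambda>u. f u $ i) u)"
proof -
  have "(\<lambda>u. f u $ i) differentiable (at u)"
    using assms bounded_linear.has_derivative[OF bounded_linear_vec_nth] unfolding differentiable_def by blast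
  from frechet_derivative_eq_pd[OF this] show ?thesis
    by (simp add: frechet_derivative_component[OF assms])
qed

lemma jacobian_component:
  assumes "f differentiable (at u)"
  shows "jacobian f (at u) $ j $ i = pd i (\<lambda>u. f u $ j) u"
  by (simp add: jacobian_def matrix_def pd_def frechet_derivative_component[OF assms])

text \<open>The hypothesis says dA = dB composed with df. On a solution this gives A_x = dB(f_x) =
  dB(u_t) = B_t, which is closedness of B dx + A dt.\<close>

lemma conservation_lawI:
  assumes V: "open V" and f: "smooth_on V f" and B: "smooth_on V B" and A: "smooth_on V A"
    and flux: "\<And>u i. u \<in> V \<Longrightarrow> pd i A u = (\<Sum>j\<in>UNIV. pd j B u * pd i (\<lambda>u. f u $ j) u)"
  shows "conservation_law V f (\<lambda>u. (B u, A u))"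
  unfolding conservation_law_def
proof (intro conjI allI impI)
  show "smooth_on V (\<lambda>u. (B u, A u))" by (rule smooth_on_Pair[OF V B A])
  fix W u
  assume sol: "solution_on V f W u"
  then have u: "smooth_on W u" and V': "u ` W \<subseteq> V" and eq: "\<And>p. p \<in> W \<Longrightarrow>
      frechet_derivative u (at p) (0, 1) = frechet_derivative (\<lambda>q. f (u q)) (at p) (1, 0)"
    unfolding solution_on_def by auto
  show "closed_form_on W (along (\<lambda>u. (B u, A u)) u)"
    unfolding closed_form_on_def
  proof (intro ballI allI)
    fix p v w
    assume p: "p \<in> W"
    let ?D = "frechet_derivative u (at p)"
    let ?dA = "frechet_derivative A (at (u p))" and ?dB = "frechet_derivative B (at (u p))"
    let ?df = "frechet_derivative f (at (u p))"
    have up: "u p \<in> V" using V' p by auto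
    note Du = smooth_on_has_derivative[OF u p]
    have dB: "((\<lambda>q. B (u q)) has_derivative (\<lambda>v. ?dB (?D v))) (at p)"
      and dA: "((\<lambda>q. A (u q)) has_derivative (\<lambda>v. ?dA (?D v))) (at p)"
      and df: "((\<lambda>q. f (u q)) has_derivative (\<lambda>v. ?df (?D v))) (at p)"
      using has_derivative_compose[OF Du smooth_on_has_derivative[OF _ up]] A B f by blast+
    have along: "frechet_derivative (\<lambda>q. along (\<lambda>u. (B u, A u)) u q w) (at p) v =
        ?dB (?D v) * fst w + ?dA (?D v) * snd w" for v w
    proof -
      have "((\<lambda>q. B (u q) * fst w + A (u q) * snd w) has_derivative
          (\<lambda>v. ?dB (?D v) * fst w + ?dA (?D v) * snd w)) (at p)"
        by (intro has_derivative_add has_derivative_mult_left dA dB)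
      then show ?thesis by (simp add: along_def frechet_derivative_eqI)
    qed
    have lin: "linear ?dA" "linear ?dB" "linear ?D"
      using smooth_on_has_derivative[OF A up] smooth_on_has_derivative[OF B up] Du has_derivative_linear by blast+
    \<comment> \<open>By bilinearity only the value of the exterior derivative on the coordinate
      vectors of the (x, t)-plane matters.\<close>
    have split: "?D v = fst v *\<^sub>R ?D (1, 0) + snd v *\<^sub>R ?D (0, 1)" for v
    proof -
      have "v = fst v *\<^sub>R (1, 0) + snd v *\<^sub>R (0, 1)" by (simp add: prod_eq_iff)
      then have "?D v = ?D (fst v *\<^sub>R (1, 0) + snd v *\<^sub>R (0, 1))" by simp
      then show ?thesis unfolding linear_add[OF lin(3)] linear_scale[OF lin(3)] .
    qed
    have "?dA x = ?dB (?df x)" for x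
    proof -
      have "?dA x = (\<Sum>i\<in>UNIV. \<Sum>j\<in>UNIV. x $ i * (pd j B (u p) * pd i (\<lambda>u. f u $ j) (u p)))"
        by (simp add: frechet_derivative_eq_pd[OF smooth_on_differentiable[OF A up]] flux[OF up] sum_distrib_left)
      also have "\<dots> = (\<Sum>j\<in>UNIV. (\<Sum>i\<in>UNIV. x $ i * pd i (\<lambda>u. f u $ j) (u p)) * pd j B (u p))"
        by (subst sum.swap) (simp add: sum_distrib_left sum_distrib_right mult_ac)
      finally show ?thesis
        by (simp add: frechet_derivative_eq_pd[OF smooth_on_differentiable[OF B up]]
            frechet_derivative_component_eq_pd[OF smooth_on_differentiable[OF f up]])
    qed
    moreover have "?D (0, 1) = ?df (?D (1, 0))"
      using eq[OF p] frechet_derivative_eqI[OF df] by simp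
    ultimately have "?dA (?D (1, 0)) = ?dB (?D (0, 1))" by simp
    then show "ext_deriv (along (\<lambda>u. (B u, A u)) u) p v w = 0"
      unfolding ext_deriv_def along split[of v] split[of w]
      by (simp add: linear_add[OF lin(1)] linear_add[OF lin(2)] linear_scale[OF lin(1)] linear_scale[OF lin(2)]
          algebra_simps)
  qed
qed

section \<open>Linear independence of the seven laws\<close>

text \<open>Differentiating a relation between the densities twice removes the constant and linear
  ones and leaves a relation between two Hessians.\<close>

lemma seven_laws_lin_indep:
  fixes f :: "real^3 \<Rightarrow> real^3"
  assumes V: "open V" and u0: "u0 \<in> V" and B: "smooth_on V B" and N: "smooth_on V N"
    and hess: "\<And>x y. (\<And>i j. x * pd i (pd j B) u0 + y * pd i (pd j N) u0 = 0) \<Longrightarrow> x = 0 \<and> y = 0"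
  shows "lin_indep_on V [\<lambda>u. (1, 0), \<lambda>u. (0, 1),
    \<lambda>u. (u $ 1, f u $ 1), \<lambda>u. (u $ 2, f u $ 2), \<lambda>u. (u $ 3, f u $ 3),
    \<lambda>u. (B u, A u), \<lambda>u. (N u, M u)]"
  unfolding lin_indep_on_def
proof (intro allI impI)
  fix c :: "nat \<Rightarrow> real" and k :: nat
  let ?ws = "[\<lambda>u. (1, 0), \<lambda>u. (0, 1),
    \<lambda>u. (u $ 1, f u $ 1), \<lambda>u. (u $ 2, f u $ 2), \<lambda>u. (u $ 3, f u $ 3),
    \<lambda>u. (B u, A u), \<lambda>u. (N u, M u)] :: law list"
  assume 0: "\<forall>u\<in>V. (\<Sum>k<length ?ws. c k *\<^sub>R (?ws ! k) u) = 0" and k: "k < length ?ws"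
  have "c 0 + (c 2 * u $ 1 + c 3 * u $ 2 + c 4 * u $ 3) + c 5 * B u + c 6 * N u = 0 \<and>
      c 1 + (c 2 * f u $ 1 + c 3 * f u $ 2 + c 4 * f u $ 3) + c 5 * A u + c 6 * M u = 0" if "u \<in> V" for u
    using 0[rule_format, OF that]
    by (simp add: numeral_eq_Suc lessThan_Suc prod_eq_iff zero_prod_def algebra_simps)
  then have 1: "c 0 + (c 2 * u $ 1 + c 3 * u $ 2 + c 4 * u $ 3) + c 5 * B u + c 6 * N u = 0"
    and 2: "c 1 + (c 2 * f u $ 1 + c 3 * f u $ 2 + c 4 * f u $ 3) + c 5 * A u + c 6 * M u = 0" if "u \<in> V" for u
    using that by auto
  define e :: "3 \<Rightarrow> real" where "e j = (if j = 1 then c 2 else if j = 2 then c 3 else c 4)" for j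
  have 3: "e j + c 5 * pd j B u + c 6 * pd j N u = 0" if u: "u \<in> V" for j u
  proof -
    let ?Z = "\<lambda>u. c 0 + (c 2 * u $ 1 + c 3 * u $ 2 + c 4 * u $ 3) + c 5 * B u + c 6 * N u"
    have coord: "((\<lambda>u. u $ k) has_derivative (\<lambda>h. h $ k)) (at u)" for k :: 3
      by (rule bounded_linear.has_derivative[OF bounded_linear_vec_nth has_derivative_ident])
    have "(?Z has_derivative (\<lambda>h. 0 + (c 2 * h $ 1 + c 3 * h $ 2 + c 4 * h $ 3) +
        c 5 * frechet_derivative B (at u) h + c 6 * frechet_derivative N (at u) h)) (at u)"
      by (intro has_derivative_add has_derivative_mult_right has_derivative_const coord
          smooth_on_has_derivative[OF B u] smooth_on_has_derivative[OF N u])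
    then have "pd j ?Z u = e j + c 5 * pd j B u + c 6 * pd j N u"
      using exhaust_3[of j] by (auto simp: pd_def frechet_derivative_eqI e_def axis_def)
    moreover have "pd j ?Z u = 0"
      using pd_cong[OF V u 1] by (simp add: pd_const)
    ultimately show ?thesis by simp
  qed
  have "c 5 * pd i (pd j B) u0 + c 6 * pd i (pd j N) u0 = 0" for i j
  proof -
    have "((\<lambda>u. e j + c 5 * pd j B u + c 6 * pd j N u) has_derivative
        (\<lambda>h. 0 + c 5 * frechet_derivative (pd j B) (at u0) h + c 6 * frechet_derivative (pd j N) (at u0) h)) (at u0)"
      by (intro has_derivative_add has_derivative_mult_right has_derivative_const
          smooth_on_has_derivative[OF smooth_on_pd[OF B] u0] smooth_on_has_derivative[OF smooth_on_pd[OF N] u0])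
    then have "pd i (\<lambda>u. e j + c 5 * pd j B u + c 6 * pd j N u) u0 = c 5 * pd i (pd j B) u0 + c 6 * pd i (pd j N) u0"
      by (simp add: pd_def[of i] frechet_derivative_eqI)
    moreover have "pd i (\<lambda>u. e j + c 5 * pd j B u + c 6 * pd j N u) u0 = 0"
      using pd_cong[OF V u0 3] by (simp add: pd_const)
    ultimately show ?thesis by simp
  qed
  \<comment> \<open>Back down the orders of differentiation: the first derivatives now leave only
    the coefficients of the coordinates, and the undifferentiated relations for density and flux
    leave \<open>c 0\<close> and \<open>c 1\<close>.\<close>
  then have 56: "c 5 = 0" "c 6 = 0" using hess by blast+
  then have "e j = 0" for j using 3[OF u0] by simp
  from this[of 1] this[of 2] this[of 3] have 234: "c 2 = 0" "c 3 = 0" "c 4 = 0" by (auto simp: e_def)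
  have "c 0 = 0" "c 1 = 0" using 1[OF u0] 2[OF u0] 56 234 by auto
  moreover have "k \<in> {0, 1, 2, 3, 4, 5, 6}" using k by auto
  ultimately show "c k = 0" using 56 234 by auto
qed

context moving_frame begin

text \<open>Contraction with \<open>X d\<close> leaves \<open>q d\<close> times the nonzero covector
  \<open>W d\<close>.\<close>

lemma frame_quadratic_eq_0:
  assumes u: "u \<in> U" and 0: "\<And>i j. (\<Sum>a\<in>UNIV. q a * W a u $ i * W a u $ j) = 0"
  shows "q d = 0"
proof -
  have "q d * W d u $ i = 0" for i
  proof -
    have "0 = (\<Sum>j\<in>UNIV. (\<Sum>a\<in>UNIV. q a * W a u $ i * W a u $ j) * X d u $ j)" by (simp add: 0)
    also have "\<dots> = (\<Sum>j\<in>UNIV. \<Sum>a\<in>UNIV. q a * W a u $ i * (W a u $ j * X d u $ j))"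
      by (simp add: sum_distrib_left sum_distrib_right mult_ac)
    also have "\<dots> = (\<Sum>a\<in>UNIV. q a * W a u $ i * (\<Sum>j\<in>UNIV. W a u $ j * X d u $ j))"
      by (subst sum.swap) (simp add: sum_distrib_left)
    finally show ?thesis by (simp add: dual[OF u] if_distrib cong: if_cong)
  qed
  moreover have "W d u \<noteq> 0" using dual[OF u, of d d] by auto
  ultimately show ?thesis by (auto simp: vec_eq_iff)
qed

end

context temple_frame begin

lemma five_conservation_laws:
  assumes ball: "U = ball u0 r" and "r > 0" and f: "smooth_on U f"
    and eigen: "\<And>u a i. u \<in> U \<Longrightarrow> (\<Sum>j\<in>UNIV. W a u $ j * pd i (\<lambda>u. f u $ j) u) = m a u * W a u $ i"
  shows "admits_five_conservation_laws U f"
proof -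
  have u0: "u0 \<in> U" using ball \<open>r > 0\<close> by simp
  obtain \<phi> where \<phi>: "smooth_on U \<phi>" "\<And>u a. u \<in> U \<Longrightarrow> dd a \<phi> u = s a u"
    using potential_of_s[OF ball] by blast
  \<comment> \<open>\<open>C\<close> and \<open>D\<close> form a basis of the triples with sum
    zero.\<close>
  define C :: "3 \<Rightarrow> real" where "C a = (if a = 1 then 1 else if a = 2 then -1 else 0)" for a
  define D :: "3 \<Rightarrow> real" where "D a = (if a = 1 then 0 else if a = 2 then 1 else -1)" for a
  have CD: "(\<Sum>a\<in>UNIV. C a) = 0" "(\<Sum>a\<in>UNIV. D a) = 0" by (simp_all add: sum_3 C_def D_def)
  note fj = smooth_on_component[OF open_U f]
  obtain B where B: "smooth_on U B" and hB: "\<And>u i j. u \<in> U \<Longrightarrow>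
      pd i (pd j B) u = (\<Sum>a\<in>UNIV. hess_coeff C \<phi> a u * W a u $ i * W a u $ j)"
    using hessian_exists[OF ball \<phi> CD(1)] by blast
  obtain N where N: "smooth_on U N" and hN: "\<And>u i j. u \<in> U \<Longrightarrow>
      pd i (pd j N) u = (\<Sum>a\<in>UNIV. hess_coeff D \<phi> a u * W a u $ i * W a u $ j)"
    using hessian_exists[OF ball \<phi> CD(2)] by blast
  obtain A where A: "smooth_on U A"
    "\<And>u i. u \<in> U \<Longrightarrow> pd i A u = (\<Sum>j\<in>UNIV. pd j B u * pd i (\<lambda>u. f u $ j) u)"
    using flux_exists[OF ball B hB fj eigen] by blast
  obtain M where M: "smooth_on U M"
    "\<And>u i. u \<in> U \<Longrightarrow> pd i M u = (\<Sum>j\<in>UNIV. pd j N u * pd i (\<lambda>u. f u $ j) u)"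
    using flux_exists[OF ball N hN fj eigen] by blast
  have indep: "x = 0 \<and> y = 0" if xy: "\<And>i j. x * pd i (pd j B) u0 + y * pd i (pd j N) u0 = 0" for x y
  proof -
    have "(\<Sum>a\<in>UNIV. (x * hess_coeff C \<phi> a u0 + y * hess_coeff D \<phi> a u0) * W a u0 $ i * W a u0 $ j) = 0" for i j
      using xy[of i j] unfolding hB[OF u0] hN[OF u0]
      by (simp add: sum_distrib_left sum.distrib[symmetric] algebra_simps)
    from frame_quadratic_eq_0[OF u0 this]
    have "x * hess_coeff C \<phi> a u0 + y * hess_coeff D \<phi> a u0 = 0" for a .
    then have "(x * C a + y * D a) * exp (\<phi> u0) / g a u0 = 0" for a
      by (simp add: hess_coeff_def add_divide_distrib distrib_right mult.assoc)
    then have "x * C a + y * D a = 0" for a using g_nonzero[OF u0] by auto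
    \<comment> \<open>At index 1 only \<open>C\<close> is nonzero, at index 3 only
      \<open>D\<close>.\<close>
    from this[of 1] this[of 3] show ?thesis by (simp add: C_def D_def)
  qed
  have "conservation_law U f (\<lambda>u. (B u, A u))" "conservation_law U f (\<lambda>u. (N u, M u))"
    using conservation_lawI[OF open_U f B A] conservation_lawI[OF open_U f N M] by blast+
  moreover note seven_laws_lin_indep[OF open_U u0 B N indep, of f A M]
  ultimately show ?thesis unfolding admits_five_conservation_laws_def by blast
qed

end

section \<open>The eigenframe of a Temple class system\<close>

context moving_frame begin

text \<open>The components of \<open>d(df) = 0\<close> in an eigenframe of the Jacobian.\<close>

lemma eigenframe_compatibility:
  assumes u: "u \<in> U" and f: "\<And>i. smooth_on U (f i)" and m: "\<And>a. smooth_on U (m a)"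
    and eig: "\<And>u a i. u \<in> U \<Longrightarrow> dd a (f i) u = m a u * X a u $ i"
  shows "(if d = b then dd a (m b) u else 0) - (if d = a then dd b (m a) u else 0)
      + m b u * G d a b u - m a u * G d b a u = (G d a b u - G d b a u) * m d u"
proof (rule frame_coeff_eq[OF u, where x = "\<lambda>d. (if d = b then dd a (m b) u else 0) -
      (if d = a then dd b (m a) u else 0) + m b u * G d a b u - m a u * G d b a u"
      and y = "\<lambda>d. (G d a b u - G d b a u) * m d u"])
  fix i
  have 2: "dd a (dd b (f i)) u = (\<Sum>d\<in>UNIV. ((if d = b then dd a (m b) u else 0) + m b u * G d a b u) * X d u $ i)"
    for a b
  proof -
    have "dd a (dd b (f i)) u = dd a (\<lambda>u. m b u * X b u $ i) u" by (rule dd_cong[OF u eig])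
    also have "\<dots> = dd a (m b) u * X b u $ i + m b u * (\<Sum>d\<in>UNIV. G d a b u * X d u $ i)"
      using dd_mult[OF m smooth_X u] dd_X[OF u] by simp
    also have "dd a (m b) u * X b u $ i = (\<Sum>d\<in>UNIV. (if d = b then dd a (m b) u else 0) * X d u $ i)"
      by (simp add: if_distrib[where f = "\<lambda>x. x * _"] cong: if_cong)
    finally show ?thesis by (simp add: sum.distrib distrib_left distrib_right sum_distrib_left mult_ac)
  qed
  have "(\<Sum>d\<in>UNIV. ((if d = b then dd a (m b) u else 0) - (if d = a then dd b (m a) u else 0) +
      m b u * G d a b u - m a u * G d b a u) * X d u $ i) = dd a (dd b (f i)) u - dd b (dd a (f i)) u"
    unfolding 2 sum_subtractf[symmetric] by (rule sum.cong) (simp_all add: algebra_simps)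
  also have "\<dots> = (\<Sum>d\<in>UNIV. (G d a b u - G d b a u) * m d u * X d u $ i)"
    by (simp add: dd_commutator[OF f u] eig[OF u] mult_ac)
  finally show "(\<Sum>d\<in>UNIV. ((if d = b then dd a (m b) u else 0) - (if d = a then dd b (m a) u else 0) +
      m b u * G d a b u - m a u * G d b a u) * X d u $ i) = (\<Sum>d\<in>UNIV. (G d a b u - G d b a u) * m d u * X d u $ i)" .
qed

section \<open>Frobenius condition for the characteristic forms\<close>

lemma ext_deriv_char_form:
  assumes u: "u \<in> U" and l: "\<And>i. smooth_on U (\<lambda>u. l c u $ i)"
  shows "ext_deriv (char_form l c) u x y =
    (\<Sum>j\<in>UNIV. \<Sum>i\<in>UNIV. (x $ j * y $ i - y $ j * x $ i) * pd j (\<lambda>u. l c u $ i) u)"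
proof -
  have D: "frechet_derivative (\<lambda>q. char_form l c q y) (at u) x =
      (\<Sum>j\<in>UNIV. \<Sum>i\<in>UNIV. (x $ j * y $ i) * pd j (\<lambda>u. l c u $ i) u)" for x y
  proof -
    have "((\<lambda>q. char_form l c q y) has_derivative
        (\<lambda>x. \<Sum>i\<in>UNIV. frechet_derivative (\<lambda>u. l c u $ i) (at u) x * y $ i)) (at u)"
      unfolding char_form_def
      by (intro has_derivative_sum has_derivative_mult_left smooth_on_has_derivative[OF l u])
    then have "frechet_derivative (\<lambda>q. char_form l c q y) (at u) x =
        (\<Sum>i\<in>UNIV. \<Sum>j\<in>UNIV. (x $ j * y $ i) * pd j (\<lambda>u. l c u $ i) u)"
      by (simp add: frechet_derivative_eqI frechet_derivative_eq_pd[OF smooth_on_differentiable[OF l u]]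
          sum_distrib_left sum_distrib_right mult_ac)
    then show ?thesis by (subst sum.swap)
  qed
  show ?thesis
    unfolding ext_deriv_def D by (simp add: sum_subtractf left_diff_distrib)
qed

text \<open>Easy half of the Frobenius theorem: the value of d\<omega> on \<open>X a\<close>,
  \<open>X b\<close> is minus \<omega> of their bracket, which vanishes under \<open>eq\<close>.
  Then d\<omega> has \<omega> as a factor, and its wedge product with \<omega> is zero.\<close>

lemma wedge_char_form_eq_0:
  assumes u: "u \<in> U" and d: "distinct [a, b, c]" and l: "\<And>i. smooth_on U (\<lambda>u. l c u $ i)"
    and lW: "\<And>u i. u \<in> U \<Longrightarrow> l c u $ i = n u * W c u $ i"
    and eq: "G c a b u = G c b a u"
  shows "wedge21 (ext_deriv (char_form l c) u) (char_form l c u) x y z = 0"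
proof -
  let ?\<beta> = "ext_deriv (char_form l c) u" and ?\<omega> = "char_form l c u"
  note \<beta> = ext_deriv_char_form[where l = l and c = c, OF u l]
  have anti: "?\<beta> x y = - ?\<beta> y x" for x y unfolding ext_deriv_def by simp
  have lin1: "linear (\<lambda>x. ?\<beta> x y)" for y
    unfolding \<beta> by (rule linearI) (simp_all add: algebra_simps sum.distrib sum_subtractf sum_distrib_left)
  have lin2: "linear (?\<beta> x)" for x
    unfolding \<beta> by (rule linearI) (simp_all add: algebra_simps sum.distrib sum_subtractf sum_distrib_left)
  have lin: "linear ?\<omega>"
    unfolding char_form_def by (rule linearI) (simp_all add: algebra_simps sum.distrib sum_distrib_left)
  have \<omega>X: "char_form l c u (X e u) = (if e = c then n u else 0)" if "u \<in> U" for e u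
    using dual[OF that, of c e]
    by (auto simp: char_form_def lW[OF that] mult.assoc sum_distrib_left[symmetric])
  define h where "h e v = (\<Sum>i\<in>UNIV. W e u $ i * v $ i)" for e v
  have expand: "v = h a v *\<^sub>R X a u + h b v *\<^sub>R X b u + h c v *\<^sub>R X c u" for v
  proof -
    have "(\<Sum>e\<in>UNIV. h e v * X e u $ j) = v $ j" for j
    proof -
      have "(\<Sum>e\<in>UNIV. h e v * X e u $ j) = (\<Sum>e\<in>UNIV. \<Sum>i\<in>UNIV. X e u $ j * W e u $ i * v $ i)"
        by (simp add: h_def sum_distrib_left sum_distrib_right mult_ac)
      also have "\<dots> = (\<Sum>i\<in>UNIV. (\<Sum>e\<in>UNIV. X e u $ j * W e u $ i) * v $ i)"
        by (subst sum.swap) (simp add: sum_distrib_right)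
      finally show ?thesis by (simp add: dual'[OF u] if_distrib[where f = "\<lambda>x. x * _"] cong: if_cong)
    qed
    then show ?thesis by (simp add: vec_eq_iff sum_UNIV_3_distinct[OF d])
  qed
  \<comment> \<open>The pairing of \<open>l c\<close> with \<open>X b\<close> is identically zero,
    so its derivative can be shifted from \<open>l c\<close> to \<open>X b\<close>.\<close>
  have ddl: "(\<Sum>i\<in>UNIV. dd a (\<lambda>u. l c u $ i) u * X b u $ i) = - n u * G c a b u" if "b \<noteq> c" for a b
  proof -
    have "dd a (\<lambda>u. \<Sum>i\<in>UNIV. l c u $ i * X b u $ i) u = 0"
      using dd_cong[where a = a, OF u \<omega>X[where e = b, unfolded char_form_def]] that by (simp add: dd_const)
    moreover have "dd a (\<lambda>u. \<Sum>i\<in>UNIV. l c u $ i * X b u $ i) u =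
        (\<Sum>i\<in>UNIV. dd a (\<lambda>u. l c u $ i * X b u $ i) u)"
      by (intro dd_sum smooth_on_mult open_U l smooth_X u)
    moreover have "(\<Sum>i\<in>UNIV. l c u $ i * dd a (\<lambda>u. X b u $ i) u) = n u * G c a b u"
      by (simp add: lW[OF u] G_def sum_distrib_left mult.assoc)
    ultimately show ?thesis by (simp add: dd_mult[OF l smooth_X u] sum.distrib)
  qed
  have "?\<beta> (X a u) (X b u) = (\<Sum>i\<in>UNIV. dd a (\<lambda>u. l c u $ i) u * X b u $ i) -
      (\<Sum>i\<in>UNIV. dd b (\<lambda>u. l c u $ i) u * X a u $ i)"
  proof -
    have "(\<Sum>i\<in>UNIV. dd a (\<lambda>u. l c u $ i) u * X b u $ i) =
        (\<Sum>j\<in>UNIV. \<Sum>i\<in>UNIV. (X a u $ j * X b u $ i) * pd j (\<lambda>u. l c u $ i) u)" for a b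
      by (subst sum.swap) (simp add: dd_def sum_distrib_left sum_distrib_right mult_ac)
    then show ?thesis unfolding \<beta> by (simp add: left_diff_distrib sum_subtractf)
  qed
  then have ab: "?\<beta> (X a u) (X b u) = 0" using ddl eq d by simp
  have same: "?\<beta> v v = 0" for v using anti[of v v] by simp
  have \<omega>: "?\<omega> v = n u * h c v" for v
    by (subst expand[of v]) (use d in \<open>simp add: linear_add[OF lin] linear_scale[OF lin] \<omega>X[OF u]\<close>)
  \<comment> \<open>Without the component on \<open>X a\<close>, \<open>X b\<close>, the two-form is
    a wedge product of some one-form with \<open>h c\<close>, and \<omega> is a multiple of
    \<open>h c\<close>.\<close>
  have \<beta>': "?\<beta> v w = (h a v * h c w - h c v * h a w) * ?\<beta> (X a u) (X c u) +
      (h b v * h c w - h c v * h b w) * ?\<beta> (X b u) (X c u)" for v w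
    apply (subst expand[of v], subst expand[of w])
    apply (simp add: linear_add[OF lin1] linear_scale[OF lin1] linear_add[OF lin2] linear_scale[OF lin2]
        same ab anti[of "X b u" "X a u"] anti[of "X c u" "X a u"] anti[of "X c u" "X b u"])
    by algebra
  show ?thesis
    unfolding wedge21_def \<beta>'[of x] \<beta>'[of y] \<beta>'[of z] \<omega> by algebra
qed

end

text \<open>Eigenvectors for three distinct eigenvalues form a basis. Applying \<open>A\<close> once
  and twice to a linear relation gives two further relations, and a combination of the three
  isolates each coefficient.\<close>

lemma orthogonal_to_eigenvectors_eq_0:
  fixes A :: "real^3^3" and \<xi> :: "3 \<Rightarrow> real^3" and \<mu> :: "3 \<Rightarrow> real"
  assumes \<xi>: "\<And>a. \<xi> a \<noteq> 0" "\<And>a. A *v \<xi> a = \<mu> a *\<^sub>R \<xi> a" and "inj \<mu>"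
    and l: "\<And>a. l \<bullet> \<xi> a = 0"
  shows "l = 0"
proof -
  define M :: "real^3^3" where "M = (\<chi> i a. \<xi> a $ i)"
  have Mv: "M *v x = (\<Sum>a\<in>UNIV. x $ a *\<^sub>R \<xi> a)" for x
    by (simp add: M_def vec_eq_iff matrix_vector_mult_def mult.commute)
  have AM: "A *v (\<Sum>a\<in>UNIV. x a *\<^sub>R \<xi> a) = (\<Sum>a\<in>UNIV. (\<mu> a * x a) *\<^sub>R \<xi> a)" for x
    by (simp add: linear_sum[OF matrix_vector_mul_linear] matrix_vector_mult_scaleR \<xi>(2) mult.commute)
  have ker: "x = 0" if "M *v x = 0" for x
  proof -
    have 0: "(\<Sum>a\<in>UNIV. x $ a *\<^sub>R \<xi> a) = 0" using that by (simp add: Mv)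
    have 1: "(\<Sum>a\<in>UNIV. (\<mu> a * x $ a) *\<^sub>R \<xi> a) = 0"
      using AM[of "\<lambda>a. x $ a"] 0 by (simp add: matrix_vector_mult_0_right)
    have 2: "(\<Sum>a\<in>UNIV. (\<mu> a * (\<mu> a * x $ a)) *\<^sub>R \<xi> a) = 0"
      using AM[of "\<lambda>a. \<mu> a * x $ a"] 1 by (simp add: matrix_vector_mult_0_right)
    have "x $ a = 0" for a
    proof -
      let ?b = "nxt a" and ?c = "prv a"
      have ne: "\<mu> a \<noteq> \<mu> ?b" "\<mu> a \<noteq> \<mu> ?c"
        using \<open>inj \<mu>\<close> distinct_nxt_prv[of a] by (auto dest: injD)
      \<comment> \<open>The combination is the polynomial (t - \<mu> b)(t - \<mu> c) evaluated at
        \<open>A\<close>, which annihilates the other two eigenvectors.\<close>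
      have "((\<mu> a - \<mu> ?b) * (\<mu> a - \<mu> ?c) * x $ a) *\<^sub>R \<xi> a =
          (\<Sum>a\<in>UNIV. (\<mu> a * (\<mu> a * x $ a)) *\<^sub>R \<xi> a) - (\<mu> ?b + \<mu> ?c) *\<^sub>R (\<Sum>a\<in>UNIV. (\<mu> a * x $ a) *\<^sub>R \<xi> a)
          + (\<mu> ?b * \<mu> ?c) *\<^sub>R (\<Sum>a\<in>UNIV. x $ a *\<^sub>R \<xi> a)"
        unfolding sum_UNIV_3_distinct[OF distinct_nxt_prv[of a]]
        by (simp add: vec_eq_iff algebra_simps)
      also have "\<dots> = 0" by (simp add: 0 1 2)
      finally show ?thesis using ne \<xi>(1)[of a] by simp
    qed
    then show ?thesis by (simp add: vec_eq_iff)
  qed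
  then obtain B where "B ** M = mat 1" using matrix_left_invertible_ker[of M] by blast
  then have "M ** B = mat 1" by (simp add: matrix_left_right_inverse)
  then have "l = M *v (B *v l)" by (simp add: matrix_vector_mul_assoc matrix_vector_mul_lid)
  then have "l \<bullet> l = l \<bullet> (M *v (B *v l))" by simp
  also have "\<dots> = 0" unfolding Mv by (simp add: inner_sum_right l)
  finally show ?thesis by simp
qed

text \<open>Around each point a ball is chosen, where the Poincare lemma is available, and the
  eigenvectors with the rescaled left eigencovectors are shown to be a \<open>temple_frame\<close>
  on it.\<close>

theorem theorem12:
  fixes U :: "(real^3) set" and f :: "real^3 \<Rightarrow> real^3"
    and \<mu> :: "3 \<Rightarrow> real^3 \<Rightarrow> real" and \<xi> l :: "3 \<Rightarrow> real^3 \<Rightarrow> real^3"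
  assumes "open U" and "smooth_on U f"
    and "strictly_hyperbolic U f \<mu> \<xi> l"
    and "temple_class U \<xi>"
    and "nondiagonalizable U l"
  shows "\<forall>u\<^sub>0\<in>U. \<exists>V. open V \<and> connected V \<and> u\<^sub>0 \<in> V \<and> V \<subseteq> U \<and> admits_five_conservation_laws V f"
proof
  fix u\<^sub>0
  assume "u\<^sub>0 \<in> U"
  then obtain r where r: "r > 0" "ball u\<^sub>0 r \<subseteq> U" using \<open>open U\<close> openE by blast
  let ?V = "ball u\<^sub>0 r"
  have V: "u \<in> U" if "u \<in> ?V" for u using that r by auto
  note hyp = \<open>strictly_hyperbolic U f \<mu> \<xi> l\<close>[unfolded strictly_hyperbolic_def]
  have smooth: "smooth_on U (\<mu> a)" "smooth_on U (\<xi> a)" "smooth_on U (l a)" for a using hyp by auto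
  have inj: "inj (\<lambda>a. \<mu> a u)" if "u \<in> ?V" for u using hyp V[OF that] by blast
  have right: "\<xi> a u \<noteq> 0" "jacobian f (at u) *v \<xi> a u = \<mu> a u *\<^sub>R \<xi> a u" if "u \<in> ?V" for u a
    using hyp V[OF that] by blast+
  have left: "l a u \<noteq> 0" "l a u v* jacobian f (at u) = \<mu> a u *\<^sub>R l a u" if "u \<in> ?V" for u a
    using hyp V[OF that] by blast+
  \<comment> \<open>The normalization that turns the left eigencovectors into the dual
    coframe.\<close>
  define n where "n a u = l a u \<bullet> \<xi> a u" for a u
  define W where "W a u = (1 / n a u) *\<^sub>R l a u" for a u
  have orth: "l a u \<bullet> \<xi> b u = 0" if u: "u \<in> ?V" and "a \<noteq> b" for a b u
  proof -
    have "\<mu> a u * (l a u \<bullet> \<xi> b u) = (l a u v* jacobian f (at u)) \<bullet> \<xi> b u" by (simp add: left[OF u])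
    also have "\<dots> = l a u \<bullet> (jacobian f (at u) *v \<xi> b u)" by (rule dot_lmul_matrix)
    also have "\<dots> = \<mu> b u * (l a u \<bullet> \<xi> b u)" by (simp add: right[OF u])
    finally show ?thesis using inj[OF u] \<open>a \<noteq> b\<close> by (auto dest: injD)
  qed
  \<comment> \<open>Otherwise \<open>l a u\<close> would be orthogonal to all three eigenvectors and
    hence zero.\<close>
  have n: "n a u \<noteq> 0" if u: "u \<in> ?V" for a u
  proof
    assume "n a u = 0"
    then have "l a u \<bullet> \<xi> b u = 0" for b using orth[OF u, of a b] by (cases "a = b") (auto simp: n_def)
    then show False using orthogonal_to_eigenvectors_eq_0[OF right[OF u] inj[OF u]] left(1)[OF u] by blast
  qed
  have sm\<xi>: "smooth_on ?V (\<lambda>u. \<xi> a u $ i)" and sml: "smooth_on ?V (\<lambda>u. l a u $ i)" for a i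
    using smooth_on_component[OF open_ball] smooth_on_subset[OF _ r(2)] smooth by blast+
  have smn: "smooth_on ?V (n a)" for a
    unfolding n_def[abs_def] inner_vec_def by (simp, intro smooth_on_sum smooth_on_mult open_ball sm\<xi> sml)
  interpret moving_frame ?V \<xi> W
  proof
    show "smooth_on ?V (\<lambda>u. W a u $ i)" for a i
      using smooth_on_divide[OF open_ball sml smn n] by (simp add: W_def)
    show "(\<Sum>i\<in>UNIV. W a u $ i * \<xi> b u $ i) = (if a = b then 1 else 0)" if u: "u \<in> ?V" for a b u
    proof -
      have "(\<Sum>i\<in>UNIV. W a u $ i * \<xi> b u $ i) = (l a u \<bullet> \<xi> b u) / n a u"
        by (simp add: W_def inner_vec_def sum_divide_distrib)
      then show ?thesis using n[OF u] orth[OF u] by (simp add: n_def)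
    qed
  qed (simp_all add: sm\<xi>)
  have smf: "smooth_on ?V f" using \<open>smooth_on U f\<close> r smooth_on_subset by blast
  note diff_f = smooth_on_differentiable[OF smf]
  have sm\<mu>: "smooth_on ?V (\<mu> a)" for a using smooth r smooth_on_subset by blast
  have eig: "dd a (\<lambda>u. f u $ i) u = \<mu> a u * \<xi> a u $ i" if u: "u \<in> ?V" for u a i
    using arg_cong[OF right(2)[OF u, of a], of "\<lambda>v. v $ i"]
    by (simp add: dd_def matrix_vector_mult_def jacobian_component[OF diff_f[OF u]] mult.commute)
  note compat = eigenframe_compatibility[OF _ smooth_on_component[OF open_ball smf] sm\<mu> eig]
  interpret temple_frame ?V \<xi> W \<mu>
  proof
    show "smooth_on ?V (\<mu> a)" for a by (rule sm\<mu>)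
    show "\<mu> a u \<noteq> \<mu> b u" if "u \<in> ?V" "a \<noteq> b" for a b u
      using inj[OF that(1)] that(2) by (auto dest: injD)
    show "G d a a u = 0" if u: "u \<in> ?V" and "d \<noteq> a" for d a u
    proof -
      have "W d u \<bullet> \<xi> a u = 0" using orth[OF u \<open>d \<noteq> a\<close>] by (simp add: W_def)
      moreover have "collinear (\<gamma> ` I)" if "integral_curve U (\<xi> a) I \<gamma>" for I \<gamma>
        using \<open>temple_class U \<xi>\<close> that unfolding temple_class_def by blast
      ultimately have "W d u \<bullet> frechet_derivative (\<xi> a) (at u) (\<xi> a u) = 0"
        using straight_integral_curves_derivative[OF \<open>open U\<close> smooth(2) V[OF u]] right(1)[OF u] by blast
      moreover have "dd a (\<lambda>u. \<xi> a u $ i) u = frechet_derivative (\<xi> a) (at u) (\<xi> a u) $ i" for i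
        by (simp add: dd_def frechet_derivative_component_eq_pd smooth_on_differentiable[OF smooth(2) V[OF u]])
      ultimately show ?thesis by (simp add: G_def inner_vec_def)
    qed
    \<comment> \<open>The compatibility equations along \<open>X b\<close> give this condition, and
      along the third direction \<open>X c\<close> the next one.\<close>
    show "dd a (\<mu> b) u = (\<mu> a u - \<mu> b u) * G b b a u" if "u \<in> ?V" "a \<noteq> b" for a b u
      using compat[OF that(1), of b b a] that(2) by (simp add: algebra_simps)
    show "(\<mu> b u - \<mu> c u) * G c a b u = (\<mu> a u - \<mu> c u) * G c b a u"
      if "u \<in> ?V" "distinct [a, b, c]" for a b c u
      using compat[OF that(1), of c b a] that(2) by (auto simp: algebra_simps)
    show "G c a b u \<noteq> G c b a u" if u: "u \<in> ?V" and d: "distinct [a, b, c]" for a b c u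
    proof
      assume "G c a b u = G c b a u"
      moreover have "l c u $ i = n c u * W c u $ i" if "u \<in> ?V" for u i using n[OF that] by (simp add: W_def)
      ultimately have "wedge21 (ext_deriv (char_form l c) u) (char_form l c u) x y z = 0" for x y z
        using wedge_char_form_eq_0[where l = l and n = "n c", OF u d sml] by blast
      then show False using \<open>nondiagonalizable U l\<close> V[OF u] unfolding nondiagonalizable_def by blast
    qed
  qed
  have "admits_five_conservation_laws ?V f"
  proof (rule five_conservation_laws[OF refl r(1) smf])
    show "(\<Sum>j\<in>UNIV. W a u $ j * pd i (\<lambda>u. f u $ j) u) = \<mu> a u * W a u $ i" if u: "u \<in> ?V" for u a i
    proof -
      have "(\<Sum>j\<in>UNIV. l a u $ j * pd i (\<lambda>u. f u $ j) u) = \<mu> a u * l a u $ i"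
        using arg_cong[OF left(2)[OF u, of a], of "\<lambda>v. v $ i"]
        by (simp add: vector_matrix_mult_def jacobian_component[OF diff_f[OF u]] mult.commute)
      then show ?thesis by (simp add: W_def sum_divide_distrib[symmetric])
    qed
  qed
  then show "\<exists>V. open V \<and> connected V \<and> u\<^sub>0 \<in> V \<and> V \<subseteq> U \<and> admits_five_conservation_laws V f"
    using r by (intro exI[of _ ?V]) (auto intro: convex_connected)
qed

end
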